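(* For any inverse monoid $S$, the generalized prefix expansion $S^{pr}$ is isomorphic to $\mathcal{FI}_{R_s}(S)$. In particular, $S^{pr}$ is generated (as an inverse monoid) by the set $[S]=\{[s]:s\in S\}$, subject to the defining relations: (1) $[1]=1$; (2) $[s][t]=[st][t]^*$ and $[s][t]=[s]^+[st]$ for all $s,t\in S$.
   Context: In an inverse monoid write $a^*=a^{-1}a$ and $a^+=aa^{-1}$. The natural partial order is $a\le b$ iff $a=eb$ for some idempotent $e$. A map $\varphi\colon S\to T$ from a monoid $S$ to an inverse monoid $T$ is a premorphism if $\varphi(1)=1$ and $\varphi(s)\varphi(t)\le\varphi(st)$ for all $s,t\in S$; it is strong if moreover $\varphi(s)\varphi(t)=\varphi(s)^+\varphi(st)$ and $\varphi(s)\varphi(t)=\varphi(st)\varphi(t)^*$ for all $s,t\in S$. $\mathcal{FI}_{R_s}(S)$, the free inverse monoid over $S$ with respect to strong premorphisms, is the inverse monoid generated by the set $\{[s]:s\in S\}$ subject to relations saying exactly that the map $s\mapsto[s]$ is a strong premorphism; it is universal among strong premorphisms from $S$ to inverse monoids. $S^{pr}$ is the Lawson–Margolis–Steinberg generalized prefix expansion of $S$. In its standard model, $S^{pr}$ is the set of pairs $(A,s)$ where $s\in S$ and $A$ is a finite subset of $S$ with $s, ss^{-1}\in A$ and $aa^{-1}=ss^{-1}$ for all $a\in A$, with multiplication $(A,s)(B,t)=\big((st)(st)^{-1}A\cup sB,\ st\big)$ and identity $(\{1\},1)$; this is an inverse monoid with $(A,s)^{-1}=(s^{-1}A,s^{-1})$,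 and $s\in S$ corresponds to $(\{s,ss^{-1}\},s)$. *)

theory Defs
  imports "HOL-Algebra.Group"
begin

section \<open>Inverse monoids and strong premorphisms\<close>

locale inverse_monoid = monoid G for G (structure) +
  assumes ex1_inverse:
    "a \<in> carrier G \<Longrightarrow>
      \<exists>!b. b \<in> carrier G \<and> a \<otimes> b \<otimes> a = a \<and> b \<otimes> a \<otimes> b = b"

text \<open>The inverse in the sense of inverse semigroups; \<open>m_inv\<close> of HOL-Algebra is the group
  inverse.\<close>

definition pinv :: "('a, 'm) monoid_scheme \<Rightarrow> 'a \<Rightarrow> 'a" where
  "pinv G a = (THE b. b \<in> carrier G \<and> a \<otimes>\<^bsub>G\<^esub> b \<otimes>\<^bsub>G\<^esub> a = a \<and> b \<otimes>\<^bsub>G\<^esub> a \<otimes>\<^bsub>G\<^esub> b = b)"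

definition pinv_star :: "('a, 'm) monoid_scheme \<Rightarrow> 'a \<Rightarrow> 'a" where
  "pinv_star G a = pinv G a \<otimes>\<^bsub>G\<^esub> a"

definition pinv_plus :: "('a, 'm) monoid_scheme \<Rightarrow> 'a \<Rightarrow> 'a" where
  "pinv_plus G a = a \<otimes>\<^bsub>G\<^esub> pinv G a"

definition natural_le :: "('a, 'm) monoid_scheme \<Rightarrow> 'a \<Rightarrow> 'a \<Rightarrow> bool" where
  "natural_le G a b \<longleftrightarrow> (\<exists>e \<in> carrier G. e \<otimes>\<^bsub>G\<^esub> e = e \<and> a = e \<otimes>\<^bsub>G\<^esub> b)"

definition premorphism ::
    "('a, 'm) monoid_scheme \<Rightarrow> ('b, 'n) monoid_scheme \<Rightarrow> ('a \<Rightarrow> 'b) \<Rightarrow> bool" where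
  "premorphism S T \<phi> \<longleftrightarrow>
     \<phi> \<in> carrier S \<rightarrow> carrier T \<and> \<phi> \<one>\<^bsub>S\<^esub> = \<one>\<^bsub>T\<^esub> \<and>
     (\<forall>s \<in> carrier S. \<forall>t \<in> carrier S. natural_le T (\<phi> s \<otimes>\<^bsub>T\<^esub> \<phi> t) (\<phi> (s \<otimes>\<^bsub>S\<^esub> t)))"

definition strong_premorphism ::
    "('a, 'm) monoid_scheme \<Rightarrow> ('b, 'n) monoid_scheme \<Rightarrow> ('a \<Rightarrow> 'b) \<Rightarrow> bool" where
  "strong_premorphism S T \<phi> \<longleftrightarrow>
     premorphism S T \<phi> \<and>
     (\<forall>s \<in> carrier S. \<forall>t \<in> carrier S.
        \<phi> s \<otimes>\<^bsub>T\<^esub> \<phi> t = pinv_plus T (\<phi> s) \<otimes>\<^bsub>T\<^esub> \<phi> (s \<otimes>\<^bsub>S\<^esub> t) \<and>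
        \<phi> s \<otimes>\<^bsub>T\<^esub> \<phi> t = \<phi> (s \<otimes>\<^bsub>S\<^esub> t) \<otimes>\<^bsub>T\<^esub> pinv_star T (\<phi> t))"

text \<open>The inverse submonoid generated by a subset.\<close>

inductive_set inverse_generate :: "('a, 'm) monoid_scheme \<Rightarrow> 'a set \<Rightarrow> 'a set"
  for G and X where
  one: "\<one>\<^bsub>G\<^esub> \<in> inverse_generate G X"
| incl: "x \<in> X \<Longrightarrow> x \<in> inverse_generate G X"
| mult: "a \<in> inverse_generate G X \<Longrightarrow> b \<in> inverse_generate G X \<Longrightarrow>
    a \<otimes>\<^bsub>G\<^esub> b \<in> inverse_generate G X"
| pinv: "a \<in> inverse_generate G X \<Longrightarrow> pinv G a \<in> inverse_generate G X"

section \<open>Presentations of inverse monoids\<close>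

text \<open>A word over \<open>X\<close> and formal inverses of its elements: the letter \<open>(x, True)\<close> stands for
  \<open>x\<close> and \<open>(x, False)\<close> for its formal inverse.\<close>

type_synonym 'a word = "('a \<times> bool) list"

definition words :: "'a set \<Rightarrow> 'a word set" where
  "words X = lists (X \<times> UNIV)"

definition gen :: "'a \<Rightarrow> 'a word" where
  "gen x = [(x, True)]"

definition winv :: "'a word \<Rightarrow> 'a word" where
  "winv w = rev (map (\<lambda>(x, b). (x, \<not> b)) w)"

text \<open>The congruence on words generated by the relations \<open>R\<close> together with the Wagner relations
  \<open>regular\<close> and \<open>commute\<close>, which define the free inverse monoid on \<open>X\<close>. It is compatible with
  \<open>winv\<close>, see \<open>presentation_pinv\<close> below.\<close>

inductive pres_cong :: "'a set \<Rightarrow> ('a word \<times> 'a word) set \<Rightarrow> 'a word \<Rightarrow> 'a word \<Rightarrow> bool"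
  for X and R where
  refl: "u \<in> words X \<Longrightarrow> pres_cong X R u u"
| sym: "pres_cong X R u v \<Longrightarrow> pres_cong X R v u"
| trans: "pres_cong X R u v \<Longrightarrow> pres_cong X R v w \<Longrightarrow> pres_cong X R u w"
| mult: "pres_cong X R u u' \<Longrightarrow> pres_cong X R v v' \<Longrightarrow> pres_cong X R (u @ v) (u' @ v')"
| regular: "u \<in> words X \<Longrightarrow> pres_cong X R (u @ winv u @ u) u"
| commute: "u \<in> words X \<Longrightarrow> v \<in> words X \<Longrightarrow>
    pres_cong X R (u @ winv u @ v @ winv v) (v @ winv v @ u @ winv u)"
| rel: "(u, v) \<in> R \<Longrightarrow> u \<in> words X \<Longrightarrow> v \<in> words X \<Longrightarrow> pres_cong X R u v"

definition pres_class :: "'a set \<Rightarrow> ('a word \<times> 'a word) set \<Rightarrow> 'a word \<Rightarrow> 'a word set" where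
  "pres_class X R u = {v. pres_cong X R u v}"

text \<open>The inverse monoid generated by \<open>X\<close> subject to the relations \<open>R\<close>.\<close>

definition inverse_presentation ::
    "'a set \<Rightarrow> ('a word \<times> 'a word) set \<Rightarrow> 'a word set monoid" where
  "inverse_presentation X R =
     \<lparr>carrier = pres_class X R ` words X,
      mult = (\<lambda>A B. \<Union>u \<in> A. \<Union>v \<in> B. pres_class X R (u @ v)),
      one = pres_class X R []\<rparr>"

section \<open>The free inverse monoid with respect to strong premorphisms\<close>

text \<open>The relations \<open>[1] = 1\<close>, \<open>[s][t] \<le> [st]\<close>, \<open>[s][t] = [s]\<^sup>+[st]\<close> and
  \<open>[s][t] = [st][t]\<^sup>*\<close>. In an inverse monoid \<open>a \<le> b\<close> holds iff \<open>a = a a\<^sup>-\<^sup>1 b\<close>, which makes the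
  second one a relation between words.\<close>

definition rel_one :: "('a, 'm) monoid_scheme \<Rightarrow> ('a word \<times> 'a word) set" where
  "rel_one S = {(gen \<one>\<^bsub>S\<^esub>, [])}"

definition rel_le :: "('a, 'm) monoid_scheme \<Rightarrow> ('a word \<times> 'a word) set" where
  "rel_le S = {(gen s @ gen t, (gen s @ gen t) @ winv (gen s @ gen t) @ gen (s \<otimes>\<^bsub>S\<^esub> t)) |
     s t. s \<in> carrier S \<and> t \<in> carrier S}"

definition rel_plus :: "('a, 'm) monoid_scheme \<Rightarrow> ('a word \<times> 'a word) set" where
  "rel_plus S = {(gen s @ gen t, (gen s @ winv (gen s)) @ gen (s \<otimes>\<^bsub>S\<^esub> t)) |
     s t. s \<in> carrier S \<and> t \<in> carrier S}"

definition rel_star :: "('a, 'm) monoid_scheme \<Rightarrow> ('a word \<times> 'a word) set" where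
  "rel_star S = {(gen s @ gen t, gen (s \<otimes>\<^bsub>S\<^esub> t) @ (winv (gen t) @ gen t)) |
     s t. s \<in> carrier S \<and> t \<in> carrier S}"

definition FI_Rs_rels :: "('a, 'm) monoid_scheme \<Rightarrow> ('a word \<times> 'a word) set" where
  "FI_Rs_rels S = rel_one S \<union> rel_le S \<union> rel_plus S \<union> rel_star S"

definition FI_Rs :: "('a, 'm) monoid_scheme \<Rightarrow> 'a word set monoid" where
  "FI_Rs S = inverse_presentation (carrier S) (FI_Rs_rels S)"

definition FI_Rs_gen :: "('a, 'm) monoid_scheme \<Rightarrow> 'a \<Rightarrow> 'a word set" where
  "FI_Rs_gen S s = pres_class (carrier S) (FI_Rs_rels S) (gen s)"

section \<open>The generalized prefix expansion\<close>

definition prefix_expansion :: "('a, 'm) monoid_scheme \<Rightarrow> ('a set \<times> 'a) monoid" where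
  "prefix_expansion S =
     \<lparr>carrier = {(A, s). s \<in> carrier S \<and> finite A \<and> A \<subseteq> carrier S \<and> s \<in> A \<and> pinv_plus S s \<in> A \<and>
        (\<forall>a \<in> A. pinv_plus S a = pinv_plus S s)},
      mult = (\<lambda>(A, s) (B, t).
        ((\<lambda>a. pinv_plus S (s \<otimes>\<^bsub>S\<^esub> t) \<otimes>\<^bsub>S\<^esub> a) ` A \<union> (\<lambda>b. s \<otimes>\<^bsub>S\<^esub> b) ` B, s \<otimes>\<^bsub>S\<^esub> t)),
      one = ({\<one>\<^bsub>S\<^esub>}, \<one>\<^bsub>S\<^esub>)\<rparr>"

definition prefix_gen :: "('a, 'm) monoid_scheme \<Rightarrow> 'a \<Rightarrow> 'a set \<times> 'a" where
  "prefix_gen S s = ({s, pinv_plus S s}, s)"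

section \<open>\<open>FI_Rs\<close> is universal among strong premorphisms\<close>

context inverse_monoid
begin

lemma pinv_props:
  assumes "a \<in> carrier G"
  shows pinv_closed [simp]: "pinv G a \<in> carrier G"
    and mult_pinv_mult: "a \<otimes> pinv G a \<otimes> a = a"
    and pinv_mult_pinv: "pinv G a \<otimes> a \<otimes> pinv G a = pinv G a"
  using theI'[OF ex1_inverse[OF assms]] by (auto simp: pinv_def)

lemma pinv_eqI:
  "a \<in> carrier G \<Longrightarrow> b \<in> carrier G \<Longrightarrow> a \<otimes> b \<otimes> a = a \<Longrightarrow> b \<otimes> a \<otimes> b = b \<Longrightarrow> pinv G a = b"
  unfolding pinv_def by (rule the1_equality[OF ex1_inverse]) auto

lemma pinv_pinv: "a \<in> carrier G \<Longrightarrow> pinv G (pinv G a) = a"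
  by (intro pinv_eqI) (simp_all add: pinv_props)

lemma pinv_idem: "e \<in> carrier G \<Longrightarrow> e \<otimes> e = e \<Longrightarrow> pinv G e = e"
  by (intro pinv_eqI) simp_all

lemma idem_mult_idem:
  assumes e: "e \<in> carrier G" "e \<otimes> e = e" and f: "f \<in> carrier G" "f \<otimes> f = f"
  shows "(e \<otimes> f) \<otimes> (e \<otimes> f) = e \<otimes> f"
proof -
  define x where "x = pinv G (e \<otimes> f)"
  have x: "x \<in> carrier G" and x1: "e \<otimes> f \<otimes> x \<otimes> (e \<otimes> f) = e \<otimes> f"
    and x2: "x \<otimes> (e \<otimes> f) \<otimes> x = x"
    using pinv_props[of "e \<otimes> f"] e f by (auto simp: x_def)
  have ee: "e \<otimes> (e \<otimes> y) = e \<otimes> y" and ff: "f \<otimes> (f \<otimes> y) = f \<otimes> y" if "y \<in> carrier G" for y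
    using e f that by (metis m_assoc)+
  have x3: "x \<otimes> (e \<otimes> (f \<otimes> (x \<otimes> e))) = x \<otimes> e"
    using arg_cong[OF x2, of "\<lambda>y. y \<otimes> e"] e(1) f(1) x by (simp add: m_assoc)
  have "pinv G (e \<otimes> f) = f \<otimes> x \<otimes> e"
    using e f x x1 x3 by (intro pinv_eqI) (simp_all add: m_assoc ee ff)
  then have xe: "x = f \<otimes> x \<otimes> e" by (simp add: x_def)
  have "x \<otimes> x = (f \<otimes> x \<otimes> e) \<otimes> (f \<otimes> x \<otimes> e)" using xe by simp
  also have "\<dots> = f \<otimes> (x \<otimes> (e \<otimes> f) \<otimes> x) \<otimes> e" using e f x by (simp add: m_assoc)
  also have "\<dots> = x" using x2 xe by simp
  finally have xx: "x \<otimes> x = x" .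
  then have "pinv G x = x" using x by (intro pinv_idem)
  moreover have "pinv G x = e \<otimes> f" using e f by (simp add: x_def pinv_pinv)
  ultimately show ?thesis using xx by simp
qed

lemma idem_commute:
  assumes e: "e \<in> carrier G" "e \<otimes> e = e" and f: "f \<in> carrier G" "f \<otimes> f = f"
  shows "e \<otimes> f = f \<otimes> e"
proof -
  have ee: "e \<otimes> (e \<otimes> y) = e \<otimes> y" and ff: "f \<otimes> (f \<otimes> y) = f \<otimes> y" if "y \<in> carrier G" for y
    using e f that by (metis m_assoc)+
  have "pinv G (e \<otimes> f) = f \<otimes> e"
    using e f idem_mult_idem[OF e f] idem_mult_idem[OF f e]
    by (intro pinv_eqI) (simp_all add: m_assoc ee ff)
  then show ?thesis using pinv_idem[of "e \<otimes> f"] idem_mult_idem[OF e f] e f by simp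
qed

lemma pinv_plus_closed [simp]: "a \<in> carrier G \<Longrightarrow> pinv_plus G a \<in> carrier G"
  by (simp add: pinv_plus_def)

lemma pinv_star_closed [simp]: "a \<in> carrier G \<Longrightarrow> pinv_star G a \<in> carrier G"
  by (simp add: pinv_star_def)

lemma pinv_plus_idem: "a \<in> carrier G \<Longrightarrow> pinv_plus G a \<otimes> pinv_plus G a = pinv_plus G a"
  by (simp add: pinv_plus_def m_assoc[symmetric] mult_pinv_mult)

lemma pinv_star_idem: "a \<in> carrier G \<Longrightarrow> pinv_star G a \<otimes> pinv_star G a = pinv_star G a"
  by (simp add: pinv_star_def m_assoc[symmetric] pinv_mult_pinv)

lemma pinv_mult:
  assumes a: "a \<in> carrier G" and b: "b \<in> carrier G"
  shows "pinv G (a \<otimes> b) = pinv G b \<otimes> pinv G a"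
proof (rule pinv_eqI)
  have c: "pinv_star G a \<otimes> pinv_plus G b = pinv_plus G b \<otimes> pinv_star G a"
    using a b by (intro idem_commute) (simp_all add: pinv_plus_idem pinv_star_idem)
  have "a \<otimes> b \<otimes> (pinv G b \<otimes> pinv G a) \<otimes> (a \<otimes> b) = a \<otimes> (pinv_plus G b \<otimes> pinv_star G a) \<otimes> b"
    using a b by (simp add: pinv_plus_def pinv_star_def m_assoc)
  also have "\<dots> = (a \<otimes> pinv G a \<otimes> a) \<otimes> (b \<otimes> pinv G b \<otimes> b)"
    unfolding c[symmetric] using a b by (simp add: pinv_plus_def pinv_star_def m_assoc)
  finally show "a \<otimes> b \<otimes> (pinv G b \<otimes> pinv G a) \<otimes> (a \<otimes> b) = a \<otimes> b"
    using a b by (simp add: mult_pinv_mult)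
  have "pinv G b \<otimes> pinv G a \<otimes> (a \<otimes> b) \<otimes> (pinv G b \<otimes> pinv G a)
      = pinv G b \<otimes> (pinv_star G a \<otimes> pinv_plus G b) \<otimes> pinv G a"
    using a b by (simp add: pinv_plus_def pinv_star_def m_assoc)
  also have "\<dots> = (pinv G b \<otimes> b \<otimes> pinv G b) \<otimes> (pinv G a \<otimes> a \<otimes> pinv G a)"
    unfolding c using a b by (simp add: pinv_plus_def pinv_star_def m_assoc)
  finally show "pinv G b \<otimes> pinv G a \<otimes> (a \<otimes> b) \<otimes> (pinv G b \<otimes> pinv G a) = pinv G b \<otimes> pinv G a"
    using a b by (simp add: pinv_mult_pinv)
qed (use a b in simp_all)

lemma natural_le_iff:
  assumes a: "a \<in> carrier G" and b: "b \<in> carrier G"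
  shows "natural_le G a b \<longleftrightarrow> a = pinv_plus G a \<otimes> b"
proof
  assume "natural_le G a b"
  then obtain e where e: "e \<in> carrier G" "e \<otimes> e = e" and ae: "a = e \<otimes> b"
    by (auto simp: natural_le_def)
  have "e \<otimes> a = a" using e b by (simp add: ae m_assoc[symmetric])
  then have ep: "e \<otimes> pinv_plus G a = pinv_plus G a" using a e by (simp add: pinv_plus_def m_assoc[symmetric])
  have "pinv_plus G a \<otimes> b = (pinv_plus G a \<otimes> e) \<otimes> b"
    using idem_commute[OF e pinv_plus_closed[OF a] pinv_plus_idem[OF a]] ep by simp
  also have "\<dots> = pinv_plus G a \<otimes> a" using a b e by (simp add: m_assoc ae[symmetric])
  also have "\<dots> = a" using a by (simp add: pinv_plus_def mult_pinv_mult)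
  finally show "a = pinv_plus G a \<otimes> b" by simp
next
  assume "a = pinv_plus G a \<otimes> b"
  then show "natural_le G a b"
    using a pinv_plus_idem[OF a] pinv_plus_closed[OF a] unfolding natural_le_def by blast
qed

end

lemma inverse_monoidI:
  fixes G (structure)
  assumes "monoid G"
    and reg: "\<And>a. a \<in> carrier G \<Longrightarrow> \<exists>b \<in> carrier G. a \<otimes> b \<otimes> a = a \<and> b \<otimes> a \<otimes> b = b"
    and comm: "\<And>e f. \<lbrakk>e \<in> carrier G; f \<in> carrier G; e \<otimes> e = e; f \<otimes> f = f\<rbrakk> \<Longrightarrow> e \<otimes> f = f \<otimes> e"
  shows "inverse_monoid G"
proof -
  interpret monoid G by fact
  show ?thesis
  proof
    fix a assume a: "a \<in> carrier G"
    show "\<exists>!b. b \<in> carrier G \<and> a \<otimes> b \<otimes> a = a \<and> b \<otimes> a \<otimes> b = b"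
    proof (rule ex_ex1I)
      show "\<exists>b. b \<in> carrier G \<and> a \<otimes> b \<otimes> a = a \<and> b \<otimes> a \<otimes> b = b" using reg[OF a] by blast
    next
      fix b c
      assume "b \<in> carrier G \<and> a \<otimes> b \<otimes> a = a \<and> b \<otimes> a \<otimes> b = b"
        and "c \<in> carrier G \<and> a \<otimes> c \<otimes> a = a \<and> c \<otimes> a \<otimes> c = c"
      then have b: "b \<in> carrier G" "a \<otimes> b \<otimes> a = a" "b \<otimes> a \<otimes> b = b"
        and c: "c \<in> carrier G" "a \<otimes> c \<otimes> a = a" "c \<otimes> a \<otimes> c = c" by auto
      have c1: "(b \<otimes> a) \<otimes> (c \<otimes> a) = (c \<otimes> a) \<otimes> (b \<otimes> a)"
        using a b c by (intro comm) (simp_all add: m_assoc[symmetric])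
      have c2: "(a \<otimes> b) \<otimes> (a \<otimes> c) = (a \<otimes> c) \<otimes> (a \<otimes> b)"
        using a b c by (intro comm) (simp_all add: m_assoc[symmetric])
      have "b \<otimes> a = b \<otimes> (a \<otimes> c \<otimes> a)" using c by simp
      also have "\<dots> = (c \<otimes> a) \<otimes> (b \<otimes> a)" using c1 a b c by (simp add: m_assoc)
      also have "\<dots> = c \<otimes> (a \<otimes> b \<otimes> a)" using a b c by (simp add: m_assoc)
      finally have ba: "b \<otimes> a = c \<otimes> a" using b by simp
      have "a \<otimes> b = (a \<otimes> c \<otimes> a) \<otimes> b" using c by simp
      also have "\<dots> = (a \<otimes> c) \<otimes> (a \<otimes> b)" using a b(1) c(1) by (simp add: m_assoc)
      also have "\<dots> = (a \<otimes> b) \<otimes> (a \<otimes> c)" using c2 by simp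
      also have "\<dots> = (a \<otimes> b \<otimes> a) \<otimes> c" using a b(1) c(1) by (simp add: m_assoc)
      finally have ab: "a \<otimes> b = a \<otimes> c" using b by simp
      have "b = b \<otimes> a \<otimes> b" using b by simp
      also have "\<dots> = c \<otimes> (a \<otimes> b)" using ba a b c by (simp add: m_assoc)
      also have "\<dots> = c" using ab c a by (simp add: m_assoc)
      finally show "b = c" .
    qed
  qed
qed

lemma words_simps [simp]:
  "[] \<in> words X" "u @ v \<in> words X \<longleftrightarrow> u \<in> words X \<and> v \<in> words X"
  "gen x \<in> words X \<longleftrightarrow> x \<in> X" "winv u \<in> words X \<longleftrightarrow> u \<in> words X"
  by (auto simp: words_def gen_def winv_def lists_eq_set)

lemma winv_winv [simp]: "winv (winv u) = u"
  by (simp add: winv_def rev_map o_def case_prod_unfold)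

lemma pres_cong_words: "pres_cong X R u v \<Longrightarrow> u \<in> words X \<and> v \<in> words X"
  by (induction rule: pres_cong.induct) auto

lemma pres_class_eq_iff:
  "u \<in> words X \<Longrightarrow> pres_class X R u = pres_class X R v \<longleftrightarrow> pres_cong X R u v"
  unfolding pres_class_def
  by (auto intro: pres_cong.refl dest: pres_cong.trans pres_cong.sym)

lemma presentation_carrier: "carrier (inverse_presentation X R) = pres_class X R ` words X"
  by (simp add: inverse_presentation_def)

lemma presentation_one: "\<one>\<^bsub>inverse_presentation X R\<^esub> = pres_class X R []"
  by (simp add: inverse_presentation_def)

lemma presentation_mult:
  assumes "u \<in> words X" "v \<in> words X"
  shows "pres_class X R u \<otimes>\<^bsub>inverse_presentation X R\<^esub> pres_class X R v = pres_class X R (u @ v)"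
proof -
  have "pres_class X R (u' @ v') = pres_class X R (u @ v)"
    if "u' \<in> pres_class X R u" "v' \<in> pres_class X R v" for u' v'
    using that assms pres_class_eq_iff[of "u @ v" X R "u' @ v'"]
    by (auto simp: pres_class_def intro: pres_cong.mult)
  then have "(\<Union>u' \<in> pres_class X R u. \<Union>v' \<in> pres_class X R v. pres_class X R (u' @ v'))
      = (\<Union>u' \<in> pres_class X R u. \<Union>v' \<in> pres_class X R v. pres_class X R (u @ v))"
    by (intro SUP_cong) auto
  moreover have "u \<in> pres_class X R u" "v \<in> pres_class X R v"
    using assms by (auto simp: pres_class_def intro: pres_cong.refl)
  ultimately show ?thesis by (auto simp: inverse_presentation_def)
qed

lemma presentation_inverse_monoid: "inverse_monoid (inverse_presentation X R)" (is "inverse_monoid ?P")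
proof (rule inverse_monoidI)
  note simps = presentation_carrier presentation_one presentation_mult
  show "monoid ?P" by unfold_locales (auto simp: simps)
  then interpret P: monoid ?P .
  have reg: "pres_class X R u \<otimes>\<^bsub>?P\<^esub> pres_class X R (winv u) \<otimes>\<^bsub>?P\<^esub> pres_class X R u = pres_class X R u"
    if "u \<in> words X" for u
    using that by (simp add: simps pres_class_eq_iff pres_cong.regular)
  have com: "pres_class X R (u @ winv u) \<otimes>\<^bsub>?P\<^esub> pres_class X R (v @ winv v)
      = pres_class X R (v @ winv v) \<otimes>\<^bsub>?P\<^esub> pres_class X R (u @ winv u)"
    if "u \<in> words X" "v \<in> words X" for u v
    using that by (simp add: simps pres_class_eq_iff pres_cong.commute)
  show "\<exists>b \<in> carrier ?P. a \<otimes>\<^bsub>?P\<^esub> b \<otimes>\<^bsub>?P\<^esub> a = a \<and> b \<otimes>\<^bsub>?P\<^esub> a \<otimes>\<^bsub>?P\<^esub> b = b"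
    if "a \<in> carrier ?P" for a
  proof -
    from that obtain u where u: "u \<in> words X" "a = pres_class X R u" by (auto simp: simps)
    show ?thesis
      using u reg[of u] reg[of "winv u"]
      by (intro bexI[of _ "pres_class X R (winv u)"]) (auto simp: presentation_carrier)
  qed
  have idem: "\<exists>u \<in> words X. e = pres_class X R (u @ winv u)"
    if e: "e \<in> carrier ?P" "e \<otimes>\<^bsub>?P\<^esub> e = e" for e
  proof -
    obtain u where u: "u \<in> words X" "e = pres_class X R u" using e by (auto simp: simps)
    define f where "f = pres_class X R (winv u)"
    have f: "f \<in> carrier ?P" using u by (auto simp: f_def simps)
    have efe: "e \<otimes>\<^bsub>?P\<^esub> f \<otimes>\<^bsub>?P\<^esub> e = e" and fef: "f \<otimes>\<^bsub>?P\<^esub> e \<otimes>\<^bsub>?P\<^esub> f = f"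
      using u reg[of u] reg[of "winv u"] by (auto simp: f_def)
    have ef: "e \<otimes>\<^bsub>?P\<^esub> f = pres_class X R (u @ winv u)" using u by (simp add: f_def simps)
    have c: "(f \<otimes>\<^bsub>?P\<^esub> e) \<otimes>\<^bsub>?P\<^esub> (e \<otimes>\<^bsub>?P\<^esub> f) = (e \<otimes>\<^bsub>?P\<^esub> f) \<otimes>\<^bsub>?P\<^esub> (f \<otimes>\<^bsub>?P\<^esub> e)"
      using com[of u "winv u"] u by (simp add: f_def simps)
    have "f = (f \<otimes>\<^bsub>?P\<^esub> e) \<otimes>\<^bsub>?P\<^esub> (e \<otimes>\<^bsub>?P\<^esub> f)"
      using e f fef by (metis P.m_assoc P.m_closed)
    then have f2: "f = e \<otimes>\<^bsub>?P\<^esub> (f \<otimes>\<^bsub>?P\<^esub> f) \<otimes>\<^bsub>?P\<^esub> e"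
      using c e f by (simp add: P.m_assoc)
    have f1: "e \<otimes>\<^bsub>?P\<^esub> f = f" using f2 e f by (metis P.m_assoc P.m_closed)
    have f3: "f \<otimes>\<^bsub>?P\<^esub> e = f" using f2 e f by (metis P.m_assoc P.m_closed)
    have "e = f" using efe f1 f3 by simp
    then have "e = pres_class X R (u @ winv u)" using ef e by simp
    then show ?thesis using u by blast
  qed
  show "e \<otimes>\<^bsub>?P\<^esub> f = f \<otimes>\<^bsub>?P\<^esub> e"
    if "e \<in> carrier ?P" "f \<in> carrier ?P" "e \<otimes>\<^bsub>?P\<^esub> e = e" "f \<otimes>\<^bsub>?P\<^esub> f = f" for e f
    using idem[OF that(1,3)] idem[OF that(2,4)] com by auto
qed

lemma presentation_pinv:
  assumes u: "u \<in> words X"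
  shows "pinv (inverse_presentation X R) (pres_class X R u) = pres_class X R (winv u)"
proof -
  interpret P: inverse_monoid "inverse_presentation X R" by (rule presentation_inverse_monoid)
  show ?thesis
    using u pres_cong.regular[of u X R] pres_cong.regular[of "winv u" X R]
    by (intro P.pinv_eqI) (auto simp: presentation_carrier presentation_mult pres_class_eq_iff)
qed

lemma FI_Rs_strong_premorphism:
  fixes S (structure)
  assumes "monoid S"
  shows "inverse_monoid (FI_Rs S)" and "strong_premorphism S (FI_Rs S) (FI_Rs_gen S)"
proof -
  interpret S: monoid S by fact
  show "inverse_monoid (FI_Rs S)" by (simp add: FI_Rs_def presentation_inverse_monoid)
  then interpret F: inverse_monoid "FI_Rs S" .
  note simps = presentation_carrier presentation_one presentation_mult presentation_pinv
    pres_class_eq_iff FI_Rs_gen_def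
  have rel: "pres_cong (carrier S) (FI_Rs_rels S) u v"
    if "(u, v) \<in> FI_Rs_rels S" "u \<in> words (carrier S)" "v \<in> words (carrier S)" for u v
    using that by (rule pres_cong.rel)
  have gc: "FI_Rs_gen S s \<in> carrier (FI_Rs S)" if "s \<in> carrier S" for s
    using that by (auto simp: FI_Rs_def simps)
  have "FI_Rs_gen S \<one> = \<one>\<^bsub>FI_Rs S\<^esub>"
    by (auto simp: FI_Rs_def simps intro!: rel)
       (auto simp: FI_Rs_rels_def rel_one_def)
  moreover have "natural_le (FI_Rs S) (FI_Rs_gen S s \<otimes>\<^bsub>FI_Rs S\<^esub> FI_Rs_gen S t) (FI_Rs_gen S (s \<otimes> t))"
    if "s \<in> carrier S" "t \<in> carrier S" for s t
    unfolding F.natural_le_iff[OF F.m_closed[OF gc gc] gc, OF that S.m_closed[OF that]]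
    using that by (auto simp: FI_Rs_def simps pinv_plus_def intro!: rel)
       (auto simp: FI_Rs_rels_def rel_le_def)
  moreover have "FI_Rs_gen S s \<otimes>\<^bsub>FI_Rs S\<^esub> FI_Rs_gen S t
      = pinv_plus (FI_Rs S) (FI_Rs_gen S s) \<otimes>\<^bsub>FI_Rs S\<^esub> FI_Rs_gen S (s \<otimes> t)"
    if "s \<in> carrier S" "t \<in> carrier S" for s t
    using that by (auto simp: FI_Rs_def simps pinv_plus_def intro!: rel)
       (auto simp: FI_Rs_rels_def rel_plus_def)
  moreover have "FI_Rs_gen S s \<otimes>\<^bsub>FI_Rs S\<^esub> FI_Rs_gen S t
      = FI_Rs_gen S (s \<otimes> t) \<otimes>\<^bsub>FI_Rs S\<^esub> pinv_star (FI_Rs S) (FI_Rs_gen S t)"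
    if "s \<in> carrier S" "t \<in> carrier S" for s t
    using that by (auto simp: FI_Rs_def simps pinv_star_def intro!: rel)
       (auto simp: FI_Rs_rels_def rel_star_def)
  ultimately show "strong_premorphism S (FI_Rs S) (FI_Rs_gen S)"
    by (auto simp: strong_premorphism_def premorphism_def gc)
qed

definition word_eval ::
    "('b, 'n) monoid_scheme \<Rightarrow> ('a \<Rightarrow> 'b) \<Rightarrow> 'a word \<Rightarrow> 'b" where
  "word_eval T \<phi> w = foldr (\<lambda>(x, b) y. (if b then \<phi> x else pinv T (\<phi> x)) \<otimes>\<^bsub>T\<^esub> y) w \<one>\<^bsub>T\<^esub>"

context inverse_monoid
begin

lemma word_eval_simps [simp]:
  "word_eval G \<phi> [] = \<one>"
  "word_eval G \<phi> ((x, b) # w) = (if b then \<phi> x else pinv G (\<phi> x)) \<otimes> word_eval G \<phi> w"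
  by (simp_all add: word_eval_def)

lemma words_Cons: "(x, b) # w \<in> words X \<longleftrightarrow> x \<in> X \<and> w \<in> words X"
  by (auto simp: words_def)

lemma word_eval_closed:
  "\<phi> \<in> X \<rightarrow> carrier G \<Longrightarrow> w \<in> words X \<Longrightarrow> word_eval G \<phi> w \<in> carrier G"
  by (induction w) (auto simp: words_Cons Pi_iff)

lemma word_eval_append:
  assumes \<phi>: "\<phi> \<in> X \<rightarrow> carrier G" and "u \<in> words X" "v \<in> words X"
  shows "word_eval G \<phi> (u @ v) = word_eval G \<phi> u \<otimes> word_eval G \<phi> v"
  using assms(2)
proof (induction u)
  case (Cons a u)
  obtain x b where "a = (x, b)" by (cases a)
  then show ?case
    using Cons \<phi> word_eval_closed[OF \<phi>] assms(3) by (auto simp: words_Cons m_assoc Pi_iff)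
qed (use assms word_eval_closed[OF \<phi>] in simp)

lemma pinv_one: "pinv G \<one> = \<one>"
  by (rule pinv_idem) simp_all

lemma word_eval_winv:
  assumes \<phi>: "\<phi> \<in> X \<rightarrow> carrier G" and "u \<in> words X"
  shows "word_eval G \<phi> (winv u) = pinv G (word_eval G \<phi> u)"
  using assms(2)
proof (induction u)
  case (Cons a u)
  obtain x b where a: "a = (x, b)" by (cases a)
  with Cons have x: "x \<in> X" "u \<in> words X" by (auto simp: words_Cons)
  have "winv (a # u) = winv u @ [(x, \<not> b)]" by (simp add: winv_def a)
  moreover have "[(x, \<not> b)] \<in> words X" using x by (simp add: words_Cons)
  moreover have "\<phi> x \<in> carrier G" using \<phi> x by auto
  ultimately show ?case
    using Cons x \<phi> word_eval_closed[OF \<phi> x(2)]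
    by (simp add: a word_eval_append[OF \<phi>] pinv_mult pinv_pinv)
qed (simp add: winv_def pinv_one)

lemma word_eval_gen: "\<phi> x \<in> carrier G \<Longrightarrow> word_eval G \<phi> (gen x) = \<phi> x"
  by (simp add: gen_def)

lemma word_eval_cong:
  assumes \<phi>: "\<phi> \<in> X \<rightarrow> carrier G"
    and R: "\<And>u v. (u, v) \<in> R \<Longrightarrow> u \<in> words X \<Longrightarrow> v \<in> words X \<Longrightarrow> word_eval G \<phi> u = word_eval G \<phi> v"
    and "pres_cong X R u v"
  shows "word_eval G \<phi> u = word_eval G \<phi> v"
  using assms(3)
proof (induction rule: pres_cong.induct)
  case (mult u u' v v')
  then show ?case using pres_cong_words word_eval_append[OF \<phi>] by metis
next
  case (regular u)
  then show ?case
    using word_eval_closed[OF \<phi>]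
    by (simp add: word_eval_append[OF \<phi>] word_eval_winv[OF \<phi>] m_assoc[symmetric] mult_pinv_mult)
next
  case (commute u v)
  then show ?case
    using word_eval_closed[OF \<phi>] idem_commute[of "pinv_plus G (word_eval G \<phi> u)" "pinv_plus G (word_eval G \<phi> v)"]
    by (simp add: word_eval_append[OF \<phi>] word_eval_winv[OF \<phi>] pinv_plus_idem)
       (simp add: pinv_plus_def m_assoc)
qed (use R in auto)

end

lemma FI_Rs_universal:
  fixes S :: "('a, 'm) monoid_scheme" and T :: "('b, 'n) monoid_scheme"
  assumes "monoid S" and "inverse_monoid T" and strong: "strong_premorphism S T \<phi>"
  shows "\<exists>h \<in> hom (FI_Rs S) T. h \<one>\<^bsub>FI_Rs S\<^esub> = \<one>\<^bsub>T\<^esub> \<and> (\<forall>s \<in> carrier S. h (FI_Rs_gen S s) = \<phi> s)"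
proof -
  interpret S: monoid S by fact
  interpret T: inverse_monoid T by fact
  define R where "R = FI_Rs_rels S"
  define h where "h A = word_eval T \<phi> (SOME u. u \<in> A)" for A
  have \<phi>: "\<phi> \<in> carrier S \<rightarrow> carrier T" using strong by (simp add: strong_premorphism_def premorphism_def)
  then have \<phi>c [simp]: "s \<in> carrier S \<Longrightarrow> \<phi> s \<in> carrier T" for s by auto
  have le: "\<phi> s \<otimes>\<^bsub>T\<^esub> \<phi> t = pinv_plus T (\<phi> s \<otimes>\<^bsub>T\<^esub> \<phi> t) \<otimes>\<^bsub>T\<^esub> \<phi> (s \<otimes>\<^bsub>S\<^esub> t)"
    if "s \<in> carrier S" "t \<in> carrier S" for s t
  proof -
    have "natural_le T (\<phi> s \<otimes>\<^bsub>T\<^esub> \<phi> t) (\<phi> (s \<otimes>\<^bsub>S\<^esub> t))"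
      using that strong unfolding strong_premorphism_def premorphism_def by blast
    then show ?thesis using that by (subst (asm) T.natural_le_iff) simp_all
  qed
  have pl: "\<phi> s \<otimes>\<^bsub>T\<^esub> \<phi> t = pinv_plus T (\<phi> s) \<otimes>\<^bsub>T\<^esub> \<phi> (s \<otimes>\<^bsub>S\<^esub> t)"
    and st: "\<phi> s \<otimes>\<^bsub>T\<^esub> \<phi> t = \<phi> (s \<otimes>\<^bsub>S\<^esub> t) \<otimes>\<^bsub>T\<^esub> pinv_star T (\<phi> t)"
    if "s \<in> carrier S" "t \<in> carrier S" for s t
    using that strong unfolding strong_premorphism_def by blast+
  note ev = T.word_eval_append[OF \<phi>] T.word_eval_winv[OF \<phi>] T.word_eval_gen
  have R: "word_eval T \<phi> u = word_eval T \<phi> v" if "(u, v) \<in> R" for u v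
  proof -
    consider "(u, v) \<in> rel_one S" | "(u, v) \<in> rel_le S" | "(u, v) \<in> rel_plus S" | "(u, v) \<in> rel_star S"
      using \<open>(u, v) \<in> R\<close> by (auto simp: R_def FI_Rs_rels_def)
    then show ?thesis
    proof cases
      case 1
      then show ?thesis
        using strong by (auto simp: rel_one_def ev strong_premorphism_def premorphism_def)
    next
      case 2
      then obtain s t where "s \<in> carrier S" "t \<in> carrier S" "u = gen s @ gen t"
        "v = (gen s @ gen t) @ winv (gen s @ gen t) @ gen (s \<otimes>\<^bsub>S\<^esub> t)"
        unfolding rel_le_def by blast
      then show ?thesis
        using le[of s t, symmetric] by (simp add: ev pinv_plus_def T.m_assoc del: append_assoc)
    next
      case 3
      then obtain s t where "s \<in> carrier S" "t \<in> carrier S" "u = gen s @ gen t"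
        "v = (gen s @ winv (gen s)) @ gen (s \<otimes>\<^bsub>S\<^esub> t)"
        unfolding rel_plus_def by blast
      then show ?thesis using pl[of s t] by (simp add: ev pinv_plus_def T.m_assoc)
    next
      case 4
      then obtain s t where "s \<in> carrier S" "t \<in> carrier S" "u = gen s @ gen t"
        "v = gen (s \<otimes>\<^bsub>S\<^esub> t) @ (winv (gen t) @ gen t)"
        unfolding rel_star_def by blast
      then show ?thesis using st[of s t] by (simp add: ev pinv_star_def T.m_assoc)
    qed
  qed
  have hc: "h (pres_class (carrier S) R u) = word_eval T \<phi> u" if "u \<in> words (carrier S)" for u
  proof -
    have "pres_cong (carrier S) R u (SOME v. v \<in> pres_class (carrier S) R u)"
      using someI[of "\<lambda>v. v \<in> pres_class (carrier S) R u" u] that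
      by (simp add: pres_class_def pres_cong.refl)
    then show ?thesis unfolding h_def using T.word_eval_cong[OF \<phi> R] by metis
  qed
  have "h \<in> hom (FI_Rs S) T"
    by (rule homI)
       (auto simp: FI_Rs_def R_def[symmetric] presentation_carrier presentation_mult hc ev
          T.word_eval_closed[OF \<phi>])
  moreover have "h \<one>\<^bsub>FI_Rs S\<^esub> = \<one>\<^bsub>T\<^esub>"
    by (simp add: FI_Rs_def R_def[symmetric] presentation_one hc)
  moreover have "\<forall>s \<in> carrier S. h (FI_Rs_gen S s) = \<phi> s"
    by (simp add: FI_Rs_gen_def R_def[symmetric] hc ev)
  ultimately show ?thesis by blast
qed

end

theory Submission
  imports Defs
begin

text \<open>The element \<open>(A, s)\<close> of \<open>S\<^sup>p\<^sup>r\<close> is the product of the idempotents \<open>[a]\<^sup>+\<close>, \<open>a \<in> A\<close>, followed by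
  \<open>[s]\<close>. Hence a strong premorphism \<open>\<phi>\<close> into an inverse monoid can only extend to \<open>S\<^sup>p\<^sup>r\<close> by
  \<open>(A, s) \<mapsto> (\<Prod>a \<in> A. \<phi>(a)\<^sup>+) \<phi>(s)\<close>. This is multiplicative because \<open>\<phi>(s) \<phi>(b)\<^sup>+ = \<phi>(sb)\<^sup>+ \<phi>(s)\<close> and
  because \<open>\<phi>(a)\<^sup>+\<close> and \<open>\<phi>(ea)\<^sup>+\<close> agree below the idempotent \<open>\<phi>(e)\<close>, where \<open>e = (st)\<^sup>+\<close>. So \<open>S\<^sup>p\<^sup>r\<close> and
  \<open>FI_Rs S\<close> have the same universal property. The relations \<open>[s][t] \<le> [st]\<close> are consequences of
  \<open>[s][t] = [s]\<^sup>+[st]\<close>.\<close>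

section \<open>Idempotents a^+ and generating sets in an inverse monoid\<close>

context inverse_monoid
begin

lemma pinv_plus_mult_self: "a \<in> carrier G \<Longrightarrow> pinv_plus G a \<otimes> a = a"
  by (simp add: pinv_plus_def mult_pinv_mult)

lemma mult_pinv_star_self: "a \<in> carrier G \<Longrightarrow> a \<otimes> pinv_star G a = a"
  by (simp add: pinv_star_def m_assoc[symmetric] mult_pinv_mult)

lemma pinv_plus_of_idem: "e \<in> carrier G \<Longrightarrow> e \<otimes> e = e \<Longrightarrow> pinv_plus G e = e"
  by (simp add: pinv_plus_def pinv_idem)

lemma pinv_plus_one: "pinv_plus G \<one> = \<one>"
  by (simp add: pinv_plus_of_idem)

lemma pinv_plus_commute:
  "a \<in> carrier G \<Longrightarrow> b \<in> carrier G \<Longrightarrow> pinv_plus G a \<otimes> pinv_plus G b = pinv_plus G b \<otimes> pinv_plus G a"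
  by (intro idem_commute) (simp_all add: pinv_plus_idem)

lemma pinv_plus_mult:
  "a \<in> carrier G \<Longrightarrow> b \<in> carrier G \<Longrightarrow> pinv_plus G (a \<otimes> b) = a \<otimes> pinv_plus G b \<otimes> pinv G a"
  by (simp add: pinv_plus_def pinv_mult m_assoc)

text \<open>Expanding (ab)^+ a gives a b^+ a^*; the idempotents b^+ and a^* commute and a a^* = a.
  The rule lets an idempotent b^+ cross a from right to left.\<close>

lemma mult_pinv_plus:
  assumes a: "a \<in> carrier G" and b: "b \<in> carrier G"
  shows "a \<otimes> pinv_plus G b = pinv_plus G (a \<otimes> b) \<otimes> a"
proof -
  have "pinv_plus G (a \<otimes> b) \<otimes> a = a \<otimes> (pinv_plus G b \<otimes> pinv_star G a)"
    using a b by (simp add: pinv_plus_mult pinv_star_def m_assoc)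
  also have "\<dots> = a \<otimes> (pinv_star G a \<otimes> pinv_plus G b)"
    using a b by (subst idem_commute) (simp_all add: pinv_plus_idem pinv_star_idem)
  also have "\<dots> = a \<otimes> pinv_plus G b"
    using a b by (simp add: m_assoc[symmetric] mult_pinv_star_self)
  finally show ?thesis by simp
qed

text \<open>Since e is its own inverse, (eb)^+ = e b^+ e, and e commutes with b^+.\<close>

lemma pinv_plus_idem_mult:
  assumes e: "e \<in> carrier G" "e \<otimes> e = e" and b: "b \<in> carrier G"
  shows "pinv_plus G (e \<otimes> b) = e \<otimes> pinv_plus G b"
proof -
  have "pinv_plus G (e \<otimes> b) = e \<otimes> (pinv_plus G b \<otimes> e)"
    using e b by (simp add: pinv_plus_mult pinv_idem m_assoc)
  also have "pinv_plus G b \<otimes> e = e \<otimes> pinv_plus G b"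
    using e b by (intro idem_commute) (simp_all add: pinv_plus_idem)
  finally show ?thesis using e b by (simp add: m_assoc[symmetric])
qed

text \<open>Because ab = a^+ (ab), the idempotent (ab)^+ lies below a^+.\<close>

lemma pinv_plus_mult_pinv_plus:
  assumes a: "a \<in> carrier G" and b: "b \<in> carrier G"
  shows "pinv_plus G (a \<otimes> b) \<otimes> pinv_plus G a = pinv_plus G (a \<otimes> b)"
proof -
  have "pinv_plus G (a \<otimes> b) = pinv_plus G (pinv_plus G a \<otimes> (a \<otimes> b))"
    using a b by (simp add: m_assoc[symmetric] pinv_plus_mult_self)
  also have "\<dots> = pinv_plus G a \<otimes> pinv_plus G (a \<otimes> b)"
    using a b by (intro pinv_plus_idem_mult) (simp_all add: pinv_plus_idem)
  finally show ?thesis using a b by (simp add: pinv_plus_commute)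
qed

lemma pinv_plus_pinv: "a \<in> carrier G \<Longrightarrow> pinv_plus G (pinv G a) = pinv_star G a"
  by (simp add: pinv_plus_def pinv_star_def pinv_pinv)

lemma inverse_generate_closed:
  assumes "X \<subseteq> carrier G"
  shows "inverse_generate G X \<subseteq> carrier G"
proof
  fix a assume "a \<in> inverse_generate G X"
  then show "a \<in> carrier G" by induction (use assms in auto)
qed

lemma hom_pinv:
  assumes "inverse_monoid H" "h \<in> hom G H" "a \<in> carrier G"
  shows "h (pinv G a) = pinv H (h a)"
proof -
  interpret H: inverse_monoid H by fact
  have "pinv H (h a) = h (pinv G a)"
    using assms
    by (intro H.pinv_eqI)
       (auto simp: hom_mult[symmetric] hom_in_carrier mult_pinv_mult pinv_mult_pinv)
  then show ?thesis by simp
qed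

text \<open>The uniqueness half of both universal properties. Inverses are preserved by
  \<open>hom_pinv\<close>; \<open>hom\<close> does not speak of the unit, hence the two assumptions
  on it.\<close>

lemma hom_eq_on_inverse_generate:
  assumes "inverse_monoid H" "f \<in> hom G H" "g \<in> hom G H" "f \<one> = \<one>\<^bsub>H\<^esub>" "g \<one> = \<one>\<^bsub>H\<^esub>"
    and X: "X \<subseteq> carrier G" "\<And>x. x \<in> X \<Longrightarrow> f x = g x"
    and a: "a \<in> inverse_generate G X"
  shows "f a = g a"
  using a
proof induction
  case (mult a b)
  then have "a \<in> carrier G" "b \<in> carrier G" using inverse_generate_closed[OF X(1)] by auto
  then show ?case using mult assms(2,3) by (simp add: hom_mult)
next
  case (pinv a)
  then have "a \<in> carrier G" using inverse_generate_closed[OF X(1)] by auto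
  then show ?case using pinv assms(1-3) by (simp add: hom_pinv)
qed (use assms in simp_all)

subsection \<open>The generalized prefix expansion\<close>

lemma prefix_expansion_carrier:
  "(A, s) \<in> carrier (prefix_expansion G) \<longleftrightarrow>
    s \<in> carrier G \<and> finite A \<and> A \<subseteq> carrier G \<and> s \<in> A \<and> pinv_plus G s \<in> A \<and>
    (\<forall>a \<in> A. pinv_plus G a = pinv_plus G s)"
  by (simp add: prefix_expansion_def)

lemma prefix_expansion_carrierD:
  assumes "(A, s) \<in> carrier (prefix_expansion G)"
  shows "s \<in> carrier G" "finite A" "A \<subseteq> carrier G" "s \<in> A" "pinv_plus G s \<in> A"
  using assms unfolding prefix_expansion_carrier by blast+

lemma prefix_expansion_plus_eq:
  "(A, s) \<in> carrier (prefix_expansion G) \<Longrightarrow> a \<in> A \<Longrightarrow> pinv_plus G a = pinv_plus G s"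
  unfolding prefix_expansion_carrier by blast

lemma prefix_expansion_mult:
  "(A, s) \<otimes>\<^bsub>prefix_expansion G\<^esub> (B, t) =
    ((\<otimes>) (pinv_plus G (s \<otimes> t)) ` A \<union> (\<otimes>) s ` B, s \<otimes> t)"
  by (simp add: prefix_expansion_def)

lemma prefix_expansion_one: "\<one>\<^bsub>prefix_expansion G\<^esub> = ({\<one>}, \<one>)"
  by (simp add: prefix_expansion_def)

text \<open>All a in A share a^+ = s^+, and a^+ a = a, so left multiplication by s^+ fixes A
  pointwise.\<close>

lemma prefix_expansion_absorb:
  assumes "(A, s) \<in> carrier (prefix_expansion G)"
  shows "(\<otimes>) (pinv_plus G s) ` A = A"
proof -
  have "pinv_plus G s \<otimes> a = a" if "a \<in> A" for a
    using prefix_expansion_carrierD(3)[OF assms] that pinv_plus_mult_self[of a]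
      prefix_expansion_plus_eq[OF assms that] by auto
  then show ?thesis by simp
qed

lemma prefix_expansion_mult_closed:
  assumes A: "(A, s) \<in> carrier (prefix_expansion G)" and B: "(B, t) \<in> carrier (prefix_expansion G)"
  shows "(A, s) \<otimes>\<^bsub>prefix_expansion G\<^esub> (B, t) \<in> carrier (prefix_expansion G)"
proof -
  note c = prefix_expansion_carrierD[OF A] prefix_expansion_carrierD[OF B]
  let ?e = "pinv_plus G (s \<otimes> t)"
  have e: "?e \<in> carrier G" "?e \<otimes> ?e = ?e" using c by (auto simp: pinv_plus_idem)
  \<comment> \<open>Here (ea)^+ = e a^+ = e s^+, and e = (st)^+ lies below s^+.\<close>
  have 1: "pinv_plus G (?e \<otimes> a) = ?e" if "a \<in> A" for a
  proof -
    have "a \<in> carrier G" using c that by auto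
    then have "pinv_plus G (?e \<otimes> a) = ?e \<otimes> pinv_plus G a" using e by (simp add: pinv_plus_idem_mult)
    also have "\<dots> = ?e"
      unfolding prefix_expansion_plus_eq[OF A that] using c by (intro pinv_plus_mult_pinv_plus)
    finally show ?thesis .
  qed
  \<comment> \<open>The value (sb)^+ = s b^+ s^-1 depends on b only through b^+ = t^+.\<close>
  have 2: "pinv_plus G (s \<otimes> b) = ?e" if "b \<in> B" for b
  proof -
    have "b \<in> carrier G" using c that by auto
    then show ?thesis using c by (simp add: pinv_plus_mult prefix_expansion_plus_eq[OF B that])
  qed
  \<comment> \<open>The witness is the element s^+ of A, for which e s^+ = e.\<close>
  have "?e \<in> (\<otimes>) ?e ` A"
    using c pinv_plus_mult_pinv_plus[of s t] by (metis imageI)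
  moreover have "\<forall>x \<in> (\<otimes>) ?e ` A \<union> (\<otimes>) s ` B. pinv_plus G x = ?e" using 1 2 by blast
  moreover have "(\<otimes>) ?e ` A \<union> (\<otimes>) s ` B \<subseteq> carrier G" using c e by blast
  ultimately show ?thesis
    using c unfolding prefix_expansion_mult prefix_expansion_carrier by blast
qed

text \<open>The set components agree piece by piece: on A since (stu)^+ lies below (st)^+, on B
  since (stu)^+ s = s (tu)^+, and on C by associativity in the base monoid.\<close>

lemma prefix_expansion_mult_assoc:
  assumes A: "(A, s) \<in> carrier (prefix_expansion G)" and B: "(B, t) \<in> carrier (prefix_expansion G)"
    and C: "(C, u) \<in> carrier (prefix_expansion G)"
  shows "(A, s) \<otimes>\<^bsub>prefix_expansion G\<^esub> (B, t) \<otimes>\<^bsub>prefix_expansion G\<^esub> (C, u)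
    = (A, s) \<otimes>\<^bsub>prefix_expansion G\<^esub> ((B, t) \<otimes>\<^bsub>prefix_expansion G\<^esub> (C, u))"
proof -
  have c: "s \<in> carrier G" "t \<in> carrier G" "u \<in> carrier G"
      "A \<subseteq> carrier G" "B \<subseteq> carrier G" "C \<subseteq> carrier G"
    using A B C by (auto simp: prefix_expansion_carrier)
  let ?e = "pinv_plus G (s \<otimes> t \<otimes> u)"
  have ee: "?e \<otimes> pinv_plus G (s \<otimes> t) = ?e"
    using c by (intro pinv_plus_mult_pinv_plus) auto
  have 1: "?e \<otimes> (pinv_plus G (s \<otimes> t) \<otimes> a) = ?e \<otimes> a" if "a \<in> A" for a
    using that c ee by (subst m_assoc[symmetric]) auto
  have 2: "?e \<otimes> (s \<otimes> b) = s \<otimes> (pinv_plus G (t \<otimes> u) \<otimes> b)" if "b \<in> B" for b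
    using that c mult_pinv_plus[of s "t \<otimes> u"]
    by (subst (1 2) m_assoc[symmetric]) (auto simp: m_assoc)
  have 3: "s \<otimes> t \<otimes> d = s \<otimes> (t \<otimes> d)" if "d \<in> C" for d
    using that c by (auto simp: m_assoc)
  have "(\<otimes>) ?e ` ((\<otimes>) (pinv_plus G (s \<otimes> t)) ` A \<union> (\<otimes>) s ` B) \<union> (\<otimes>) (s \<otimes> t) ` C
      = (\<otimes>) ?e ` A \<union> (\<otimes>) s ` ((\<otimes>) (pinv_plus G (t \<otimes> u)) ` B \<union> (\<otimes>) t ` C)"
    unfolding image_Un image_image using 1 2 3 by (simp add: Un_assoc)
  then show ?thesis using c by (simp add: prefix_expansion_mult m_assoc)
qed

lemma prefix_expansion_monoid: "monoid (prefix_expansion G)"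
proof (rule monoidI; clarify?)
  show "\<one>\<^bsub>prefix_expansion G\<^esub> \<in> carrier (prefix_expansion G)"
    by (simp add: prefix_expansion_one prefix_expansion_carrier pinv_plus_one)
next
  fix A s assume A: "(A, s) \<in> carrier (prefix_expansion G)"
  note c = prefix_expansion_carrierD[OF A]
  have "(\<otimes>) \<one> ` A = A" using c by (auto simp: subset_iff)
  then show "\<one>\<^bsub>prefix_expansion G\<^esub> \<otimes>\<^bsub>prefix_expansion G\<^esub> (A, s) = (A, s)"
    using c by (auto simp: prefix_expansion_one prefix_expansion_mult)
  show "(A, s) \<otimes>\<^bsub>prefix_expansion G\<^esub> \<one>\<^bsub>prefix_expansion G\<^esub> = (A, s)"
    using c prefix_expansion_absorb[OF A] by (auto simp: prefix_expansion_one prefix_expansion_mult)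
qed (use prefix_expansion_mult_closed prefix_expansion_mult_assoc in auto)

text \<open>Multiplying (A, s) with (s^-1 A, s^-1) in either order adds no new elements to the set
  of the left factor, because s undoes s^-1 on A. The two regularity laws then follow from
  \<open>prefix_expansion_absorb\<close>.\<close>

lemma prefix_expansion_pinv_props:
  assumes A: "(A, s) \<in> carrier (prefix_expansion G)"
  shows prefix_expansion_pinv_closed: "((\<otimes>) (pinv G s) ` A, pinv G s) \<in> carrier (prefix_expansion G)"
    and prefix_expansion_mult_pinv:
      "(A, s) \<otimes>\<^bsub>prefix_expansion G\<^esub> ((\<otimes>) (pinv G s) ` A, pinv G s) = (A, pinv_plus G s)"
    and prefix_expansion_pinv_mult:
      "((\<otimes>) (pinv G s) ` A, pinv G s) \<otimes>\<^bsub>prefix_expansion G\<^esub> (A, s)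
        = ((\<otimes>) (pinv G s) ` A, pinv_star G s)"
    and prefix_expansion_regular:
      "(A, pinv_plus G s) \<otimes>\<^bsub>prefix_expansion G\<^esub> (A, s) = (A, s)"
    and prefix_expansion_regular':
      "((\<otimes>) (pinv G s) ` A, pinv_star G s) \<otimes>\<^bsub>prefix_expansion G\<^esub> ((\<otimes>) (pinv G s) ` A, pinv G s)
        = ((\<otimes>) (pinv G s) ` A, pinv G s)"
proof -
  note c = prefix_expansion_carrierD[OF A]
  let ?s = "pinv G s" let ?B = "(\<otimes>) ?s ` A"
  have s: "s \<in> carrier G" "?s \<in> carrier G" using c by auto
  have plus: "pinv_plus G (?s \<otimes> a) = pinv_plus G ?s" if "a \<in> A" for a
  proof -
    have "a \<in> carrier G" using c that by auto
    then have "pinv_plus G (?s \<otimes> a) = ?s \<otimes> (s \<otimes> ?s) \<otimes> s"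
      using s by (simp add: pinv_plus_mult pinv_pinv prefix_expansion_plus_eq[OF A that])
        (simp add: pinv_plus_def)
    also have "\<dots> = pinv_plus G ?s"
      using s by (simp add: m_assoc[symmetric] pinv_mult_pinv pinv_plus_pinv pinv_star_def)
    finally show ?thesis .
  qed
  \<comment> \<open>The set s^-1 A contains s^-1 s as the image of s, and s^-1 as the image of s^+;
    this is where the membership of s and s^+ in A is used.\<close>
  have "pinv_plus G ?s = ?s \<otimes> s" using s by (simp add: pinv_plus_pinv pinv_star_def)
  then have 1: "pinv_plus G ?s \<in> ?B" using c by blast
  have "?s = ?s \<otimes> pinv_plus G s"
    using s by (simp add: pinv_plus_def m_assoc[symmetric] pinv_mult_pinv)
  then have 2: "?s \<in> ?B" using c by blast
  show closed: "(?B, ?s) \<in> carrier (prefix_expansion G)"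
    unfolding prefix_expansion_carrier using 1 2 c s plus by auto
  \<comment> \<open>On A the product s s^-1 acts as s^+ = a^+, which fixes a.\<close>
  have sa: "s \<otimes> (?s \<otimes> a) = a" if "a \<in> A" for a
  proof -
    have a: "a \<in> carrier G" using c that by auto
    then have "s \<otimes> (?s \<otimes> a) = pinv_plus G a \<otimes> a"
      unfolding prefix_expansion_plus_eq[OF A that] using s by (simp add: pinv_plus_def m_assoc)
    then show ?thesis using a by (simp add: pinv_plus_mult_self)
  qed
  have sB: "(\<otimes>) s ` ?B = A" using sa by (simp add: image_image)
  have e: "s \<otimes> ?s = pinv_plus G s" "?s \<otimes> s = pinv_star G s"
    by (simp_all add: pinv_plus_def pinv_star_def)
  have ei: "pinv_plus G (pinv_plus G s) = pinv_plus G s"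
      "pinv_plus G (pinv_star G s) = pinv_plus G ?s"
    using s by (simp_all add: pinv_plus_of_idem pinv_plus_idem pinv_star_idem pinv_plus_pinv)
  show "(A, s) \<otimes>\<^bsub>prefix_expansion G\<^esub> (?B, ?s) = (A, pinv_plus G s)"
    using prefix_expansion_absorb[OF A] sB by (simp add: prefix_expansion_mult e ei)
  show "(?B, ?s) \<otimes>\<^bsub>prefix_expansion G\<^esub> (A, s) = (?B, pinv_star G s)"
    using prefix_expansion_absorb[OF closed] by (simp add: prefix_expansion_mult e ei)
  show "(A, pinv_plus G s) \<otimes>\<^bsub>prefix_expansion G\<^esub> (A, s) = (A, s)"
    using s prefix_expansion_absorb[OF A] by (simp add: prefix_expansion_mult pinv_plus_mult_self)
  show "(?B, pinv_star G s) \<otimes>\<^bsub>prefix_expansion G\<^esub> (?B, ?s) = (?B, ?s)"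
    using s prefix_expansion_absorb[OF closed]
    by (simp add: prefix_expansion_mult pinv_plus_pinv[symmetric] pinv_plus_mult_self)
qed

text \<open>An idempotent (E, e) has e idempotent and eE = E. Hence (E, e)(F, f) = (ef(E \<union>
  F), ef) for idempotents, which is symmetric.\<close>

lemma prefix_expansion_inverse_monoid: "inverse_monoid (prefix_expansion G)"
proof (rule inverse_monoidI[OF prefix_expansion_monoid])
  fix x assume "x \<in> carrier (prefix_expansion G)"
  moreover obtain A s where "x = (A, s)" by fastforce
  ultimately show "\<exists>y \<in> carrier (prefix_expansion G).
      x \<otimes>\<^bsub>prefix_expansion G\<^esub> y \<otimes>\<^bsub>prefix_expansion G\<^esub> x = x \<and>
      y \<otimes>\<^bsub>prefix_expansion G\<^esub> x \<otimes>\<^bsub>prefix_expansion G\<^esub> y = y"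
    using prefix_expansion_pinv_props[of A s] by metis
next
  fix x y
  assume x: "x \<in> carrier (prefix_expansion G)" "x \<otimes>\<^bsub>prefix_expansion G\<^esub> x = x"
    and y: "y \<in> carrier (prefix_expansion G)" "y \<otimes>\<^bsub>prefix_expansion G\<^esub> y = y"
  obtain E e F f where xy: "x = (E, e)" "y = (F, f)" by fastforce
  note E = x[unfolded xy] and F = y[unfolded xy]
  have e: "e \<in> carrier G" "e \<otimes> e = e" and f: "f \<in> carrier G" "f \<otimes> f = f"
    and sub: "E \<subseteq> carrier G" "F \<subseteq> carrier G"
    using E F by (auto simp: prefix_expansion_carrier prefix_expansion_mult)
  have ef: "e \<otimes> f = f \<otimes> e" by (rule idem_commute[OF e f])
  have pe: "pinv_plus G (e \<otimes> f) = e \<otimes> f"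
    using e f by (intro pinv_plus_of_idem) (simp_all add: idem_mult_idem)
  have 1: "(\<otimes>) f ` E = (\<otimes>) (e \<otimes> f) ` E"
  proof -
    have "(\<otimes>) (e \<otimes> f) ` E = (\<otimes>) f ` (\<otimes>) e ` E"
      unfolding image_image ef using e f sub by (intro image_cong) (auto simp: m_assoc)
    then show ?thesis using prefix_expansion_absorb[OF E(1)] e by (simp add: pinv_plus_of_idem)
  qed
  have 2: "(\<otimes>) e ` F = (\<otimes>) (e \<otimes> f) ` F"
  proof -
    have "(\<otimes>) (e \<otimes> f) ` F = (\<otimes>) e ` (\<otimes>) f ` F"
      unfolding image_image using e f sub by (intro image_cong) (auto simp: m_assoc)
    then show ?thesis using prefix_expansion_absorb[OF F(1)] f by (simp add: pinv_plus_of_idem)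
  qed
  show "x \<otimes>\<^bsub>prefix_expansion G\<^esub> y = y \<otimes>\<^bsub>prefix_expansion G\<^esub> x"
    unfolding xy prefix_expansion_mult 1 2 using ef pe by (simp add: Un_commute)
qed

lemma prefix_expansion_pinv:
  assumes "(A, s) \<in> carrier (prefix_expansion G)"
  shows "pinv (prefix_expansion G) (A, s) = ((\<otimes>) (pinv G s) ` A, pinv G s)"
proof -
  interpret P: inverse_monoid "prefix_expansion G" by (rule prefix_expansion_inverse_monoid)
  show ?thesis
    by (intro P.pinv_eqI) (simp_all add: assms prefix_expansion_pinv_props[OF assms])
qed

lemma prefix_expansion_plus:
  "(A, s) \<in> carrier (prefix_expansion G) \<Longrightarrow>
    pinv_plus (prefix_expansion G) (A, s) = (A, pinv_plus G s)"
  by (simp add: pinv_plus_def[of "prefix_expansion G"] prefix_expansion_pinv prefix_expansion_mult_pinv)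

lemma prefix_expansion_star:
  "(A, s) \<in> carrier (prefix_expansion G) \<Longrightarrow>
    pinv_star (prefix_expansion G) (A, s) = ((\<otimes>) (pinv G s) ` A, pinv_star G s)"
  by (simp add: pinv_star_def[of "prefix_expansion G"] prefix_expansion_pinv prefix_expansion_pinv_mult)

section \<open>The generators [s] of the prefix expansion\<close>

lemma prefix_gen_closed: "s \<in> carrier G \<Longrightarrow> prefix_gen G s \<in> carrier (prefix_expansion G)"
  by (simp add: prefix_gen_def prefix_expansion_carrier pinv_plus_of_idem pinv_plus_idem)

text \<open>The order relation asks for an idempotent factor in front of \<phi>(st), and
  \<open>plus\<close> supplies \<phi>(s)^+.\<close>

lemma strong_premorphismI:
  assumes "inverse_monoid T" and \<phi>: "\<phi> \<in> carrier G \<rightarrow> carrier T" and one: "\<phi> \<one> = \<one>\<^bsub>T\<^esub>"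
    and plus: "\<And>s t. s \<in> carrier G \<Longrightarrow> t \<in> carrier G \<Longrightarrow>
      \<phi> s \<otimes>\<^bsub>T\<^esub> \<phi> t = pinv_plus T (\<phi> s) \<otimes>\<^bsub>T\<^esub> \<phi> (s \<otimes> t)"
    and star: "\<And>s t. s \<in> carrier G \<Longrightarrow> t \<in> carrier G \<Longrightarrow>
      \<phi> s \<otimes>\<^bsub>T\<^esub> \<phi> t = \<phi> (s \<otimes> t) \<otimes>\<^bsub>T\<^esub> pinv_star T (\<phi> t)"
  shows "strong_premorphism G T \<phi>"
proof -
  interpret T: inverse_monoid T by fact
  have \<phi>c: "\<phi> s \<in> carrier T" if "s \<in> carrier G" for s using \<phi> that by auto
  have "natural_le T (\<phi> s \<otimes>\<^bsub>T\<^esub> \<phi> t) (\<phi> (s \<otimes> t))" if "s \<in> carrier G" "t \<in> carrier G" for s t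
    unfolding natural_le_def
    using plus[OF that] \<phi>c that by (intro bexI[of _ "pinv_plus T (\<phi> s)"]) (auto simp: T.pinv_plus_idem)
  then show ?thesis
    using \<phi> one plus star unfolding strong_premorphism_def premorphism_def by blast
qed

text \<open>The elements [s][t], [s]^+ [st] and [st] [t]^* are all computed to be ({s t^+, (st)^+,
  st}, st). In the first product s t^+ arises twice, once as (st)^+ s.\<close>

lemma prefix_gen_strong_premorphism: "strong_premorphism G (prefix_expansion G) (prefix_gen G)"
proof (rule strong_premorphismI[OF prefix_expansion_inverse_monoid])
  show "prefix_gen G \<in> carrier G \<rightarrow> carrier (prefix_expansion G)" by (simp add: prefix_gen_closed)
  show "prefix_gen G \<one> = \<one>\<^bsub>prefix_expansion G\<^esub>"
    by (simp add: prefix_gen_def pinv_plus_one prefix_expansion_one)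
next
  fix s t assume s: "s \<in> carrier G" and t: "t \<in> carrier G"
  let ?e = "pinv_plus G (s \<otimes> t)"
  have eq: "?e \<otimes> s = s \<otimes> pinv_plus G t" "?e \<otimes> pinv_plus G s = ?e" "pinv_plus G s \<otimes> ?e = ?e"
    using s t pinv_plus_commute[of s "s \<otimes> t"] mult_pinv_plus[of s t]
    by (simp_all add: pinv_plus_mult_pinv_plus)
  have eq': "pinv_plus G s \<otimes> (s \<otimes> t) = s \<otimes> t" "s \<otimes> t \<otimes> pinv_star G t = s \<otimes> t"
      "s \<otimes> t \<otimes> pinv G t = s \<otimes> pinv_plus G t" "pinv G t \<otimes> pinv_plus G t = pinv G t"
    using s t by (simp_all add: m_assoc[symmetric] pinv_plus_mult_self)
      (simp_all add: m_assoc mult_pinv_star_self pinv_plus_def pinv_mult_pinv, simp add: m_assoc[symmetric] pinv_mult_pinv)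
  have eq'': "?e \<otimes> (s \<otimes> t) = s \<otimes> t" "?e \<otimes> ?e = ?e"
    using s t by (simp_all add: pinv_plus_mult_self pinv_plus_idem)
  have prod: "prefix_gen G s \<otimes>\<^bsub>prefix_expansion G\<^esub> prefix_gen G t
      = ({s \<otimes> pinv_plus G t, ?e, s \<otimes> t}, s \<otimes> t)"
    by (auto simp: prefix_gen_def prefix_expansion_mult eq)
  have "pinv_plus (prefix_expansion G) (prefix_gen G s) = ({s, pinv_plus G s}, pinv_plus G s)"
    using prefix_gen_closed[OF s] by (simp add: prefix_gen_def prefix_expansion_plus)
  then show "prefix_gen G s \<otimes>\<^bsub>prefix_expansion G\<^esub> prefix_gen G t
      = pinv_plus (prefix_expansion G) (prefix_gen G s) \<otimes>\<^bsub>prefix_expansion G\<^esub> prefix_gen G (s \<otimes> t)"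
    unfolding prod by (auto simp: prefix_gen_def prefix_expansion_mult eq eq')
  \<comment> \<open>The set component is t^-1 {t, t^+}, and t^-1 t^+ = t^-1.\<close>
  have "pinv_star (prefix_expansion G) (prefix_gen G t) = ({pinv_star G t, pinv G t}, pinv_star G t)"
    using prefix_gen_closed[OF t] eq'(4)
    by (simp add: prefix_gen_def prefix_expansion_star) (simp add: pinv_star_def)
  then show "prefix_gen G s \<otimes>\<^bsub>prefix_expansion G\<^esub> prefix_gen G t
      = prefix_gen G (s \<otimes> t) \<otimes>\<^bsub>prefix_expansion G\<^esub> pinv_star (prefix_expansion G) (prefix_gen G t)"
    unfolding prod by (auto simp: prefix_gen_def prefix_expansion_mult eq' eq'')
qed

text \<open>If a^+ = s^+, left multiplication by [a]^+ = ({a, s^+}, s^+) inserts a into the set of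
  (C, s) and changes nothing else. So (A, s) is reached from [s] in finitely many steps.\<close>

lemma prefix_expansion_generated:
  "inverse_generate (prefix_expansion G) (prefix_gen G ` carrier G) = carrier (prefix_expansion G)"
  (is "?I = _")
proof
  interpret P: inverse_monoid "prefix_expansion G" by (rule prefix_expansion_inverse_monoid)
  show "?I \<subseteq> carrier (prefix_expansion G)"
    by (rule P.inverse_generate_closed) (auto simp: prefix_gen_closed)
  show "carrier (prefix_expansion G) \<subseteq> ?I"
  proof clarify
    fix A s assume A: "(A, s) \<in> carrier (prefix_expansion G)"
    note c = prefix_expansion_carrierD[OF A]
    have gen: "prefix_gen G a \<in> ?I" if "a \<in> carrier G" for a
      using that by (auto intro: inverse_generate.incl)
    \<comment> \<open>The elements s and s^+ are kept at every stage, so that each intermediate pair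
      lies in the carrier.\<close>
    have "finite B \<Longrightarrow> B \<subseteq> A \<Longrightarrow> (B \<union> {s, pinv_plus G s}, s) \<in> ?I" for B
    proof (induction rule: finite_induct)
      case empty
      then show ?case using gen[of s] c by (simp add: prefix_gen_def)
    next
      case (insert a B)
      let ?e = "pinv_plus G s" let ?C = "B \<union> {s, ?e}"
      have "a \<in> A" using insert by simp
      then have a: "a \<in> carrier G" "pinv_plus G a = ?e"
        using c by (blast, intro prefix_expansion_plus_eq[OF A])
      have "?C \<subseteq> A" using insert c by auto
      then have "(?C, s) \<in> carrier (prefix_expansion G)"
        using insert.hyps c prefix_expansion_plus_eq[OF A]
        unfolding prefix_expansion_carrier by blast
      then have C: "(\<otimes>) ?e ` ?C = ?C" by (rule prefix_expansion_absorb)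
      have "pinv_plus (prefix_expansion G) (prefix_gen G a) = ({a, ?e}, ?e)"
        using prefix_gen_closed[OF a(1)] a by (simp add: prefix_gen_def prefix_expansion_plus)
      then have "pinv_plus (prefix_expansion G) (prefix_gen G a) \<otimes>\<^bsub>prefix_expansion G\<^esub> (?C, s)
          = ({?e \<otimes> a, ?e \<otimes> ?e} \<union> ?C, s)"
        using c C by (simp add: prefix_expansion_mult pinv_plus_mult_self)
      also have "\<dots> = (insert a B \<union> {s, ?e}, s)"
        using pinv_plus_mult_self[OF a(1)] pinv_plus_idem[of s] a c by auto
      finally have eq: "pinv_plus (prefix_expansion G) (prefix_gen G a) \<otimes>\<^bsub>prefix_expansion G\<^esub> (?C, s)
          = (insert a B \<union> {s, ?e}, s)" .
      have "(?C, s) \<in> ?I" using insert by blast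
      then show ?case
        unfolding eq[symmetric] pinv_plus_def[of "prefix_expansion G"] using gen[OF a(1)]
        by (intro inverse_generate.mult inverse_generate.pinv)
    qed
    \<comment> \<open>A already contains s and s^+, so B = A gives the pair itself.\<close>
    from this[of A] show "(A, s) \<in> ?I" using c by (simp add: insert_absorb)
  qed
qed

subsection \<open>Extension of strong premorphisms to the prefix expansion\<close>

text \<open>Lists allow induction, concatenation and mapping by a left multiplication that may
  identify entries. As the factors are commuting idempotents, the value depends only on the set of
  entries.\<close>

definition meet_plus :: "('c \<Rightarrow> 'a) \<Rightarrow> 'c list \<Rightarrow> 'a" where
  "meet_plus \<phi> xs = foldr (\<lambda>x y. pinv_plus G (\<phi> x) \<otimes> y) xs \<one>"

lemma meet_plus_simps [simp]:
  "meet_plus \<phi> [] = \<one>"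
  "meet_plus \<phi> (x # xs) = pinv_plus G (\<phi> x) \<otimes> meet_plus \<phi> xs"
  by (simp_all add: meet_plus_def)

lemma meet_plus_closed: "\<phi> ` set xs \<subseteq> carrier G \<Longrightarrow> meet_plus \<phi> xs \<in> carrier G"
  by (induction xs) auto

lemma meet_plus_append:
  "\<phi> ` set xs \<subseteq> carrier G \<Longrightarrow> \<phi> ` set ys \<subseteq> carrier G \<Longrightarrow>
    meet_plus \<phi> (xs @ ys) = meet_plus \<phi> xs \<otimes> meet_plus \<phi> ys"
  by (induction xs) (auto simp: meet_plus_closed m_assoc)

lemma meet_plus_idem:
  "\<phi> ` set xs \<subseteq> carrier G \<Longrightarrow> meet_plus \<phi> xs \<otimes> meet_plus \<phi> xs = meet_plus \<phi> xs"
  by (induction xs) (auto simp: meet_plus_closed intro!: idem_mult_idem pinv_plus_idem)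

lemma meet_plus_commute:
  assumes "\<phi> ` set xs \<subseteq> carrier G" "e \<in> carrier G" "e \<otimes> e = e"
  shows "meet_plus \<phi> xs \<otimes> e = e \<otimes> meet_plus \<phi> xs"
  using assms by (intro idem_commute) (simp_all add: meet_plus_closed meet_plus_idem)

text \<open>The factor \<phi>(x)^+ commutes past the others until it meets its own copy, where
  idempotence absorbs it.\<close>

lemma meet_plus_absorb:
  assumes "\<phi> ` set xs \<subseteq> carrier G" "x \<in> set xs"
  shows "meet_plus \<phi> xs \<otimes> pinv_plus G (\<phi> x) = meet_plus \<phi> xs"
proof -
  have x: "\<phi> x \<in> carrier G" using assms by auto
  have "pinv_plus G (\<phi> x) \<otimes> meet_plus \<phi> xs = meet_plus \<phi> xs"
    using assms
  proof (induction xs)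
    case (Cons y ys)
    have y: "\<phi> y \<in> carrier G" "\<phi> ` set ys \<subseteq> carrier G" using Cons.prems by auto
    have "pinv_plus G (\<phi> x) \<otimes> (pinv_plus G (\<phi> y) \<otimes> meet_plus \<phi> ys)
        = pinv_plus G (\<phi> y) \<otimes> (pinv_plus G (\<phi> x) \<otimes> meet_plus \<phi> ys)"
      using x y pinv_plus_commute[OF x y(1)] meet_plus_closed[OF y(2)] by (simp add: m_assoc[symmetric])
    moreover have "pinv_plus G (\<phi> y) \<otimes> (pinv_plus G (\<phi> y) \<otimes> meet_plus \<phi> ys)
        = pinv_plus G (\<phi> y) \<otimes> meet_plus \<phi> ys"
      using y meet_plus_closed[OF y(2)] by (simp add: m_assoc[symmetric] pinv_plus_idem)
    ultimately show ?case using Cons y by (cases "x = y") auto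
  qed simp
  then show ?thesis using assms x by (simp add: meet_plus_commute pinv_plus_idem)
qed

lemma meet_plus_mult_subset:
  assumes "\<phi> ` set xs \<subseteq> carrier G" "set ys \<subseteq> set xs"
  shows "meet_plus \<phi> xs \<otimes> meet_plus \<phi> ys = meet_plus \<phi> xs"
  using assms(2)
proof (induction ys)
  case (Cons y ys)
  then have "\<phi> y \<in> carrier G" "\<phi> ` set ys \<subseteq> carrier G" using assms(1) by auto
  then show ?case
    using Cons assms(1) meet_plus_absorb[OF assms(1), of y]
    by (simp add: m_assoc[symmetric] meet_plus_closed)
qed (use assms in \<open>simp add: meet_plus_closed\<close>)

text \<open>The two products are commuting idempotents, each absorbing the other, hence
  equal.\<close>

lemma meet_plus_cong_set:
  assumes "\<phi> ` set xs \<subseteq> carrier G" "set xs = set ys"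
  shows "meet_plus \<phi> xs = meet_plus \<phi> ys"
proof -
  have "meet_plus \<phi> xs = meet_plus \<phi> xs \<otimes> meet_plus \<phi> ys"
    using meet_plus_mult_subset[of \<phi> xs ys] assms by simp
  also have "\<dots> = meet_plus \<phi> ys \<otimes> meet_plus \<phi> xs"
    using assms by (intro meet_plus_commute) (auto simp: meet_plus_closed meet_plus_idem)
  also have "\<dots> = meet_plus \<phi> ys"
    using meet_plus_mult_subset[of \<phi> ys xs] assms by simp
  finally show ?thesis .
qed

text \<open>The enumeration is an arbitrary choice; for finite sets with images in the carrier,
  \<open>meet_plus_cong_set\<close> shows that every choice gives the same value.\<close>

definition meet_plus_set :: "('c \<Rightarrow> 'a) \<Rightarrow> 'c set \<Rightarrow> 'a" where
  "meet_plus_set \<phi> A = meet_plus \<phi> (SOME xs. set xs = A)"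

lemma meet_plus_set_eq:
  assumes "\<phi> ` set xs \<subseteq> carrier G"
  shows "meet_plus_set \<phi> (set xs) = meet_plus \<phi> xs"
proof -
  have "set (SOME ys. set ys = set xs) = set xs" by (rule someI) simp
  then show ?thesis
    unfolding meet_plus_set_def using assms by (intro meet_plus_cong_set) simp_all
qed

end

section \<open>Existence of the extension to the prefix expansion\<close>

lemma strong_premorphism_extends:
  fixes S :: "('a, 'm) monoid_scheme" (structure) and T :: "('b, 'n) monoid_scheme"
  assumes "inverse_monoid S" and "inverse_monoid T" and strong: "strong_premorphism S T \<phi>"
  shows "\<exists>h \<in> hom (prefix_expansion S) T. h \<one>\<^bsub>prefix_expansion S\<^esub> = \<one>\<^bsub>T\<^esub> \<and>
    (\<forall>s \<in> carrier S. h (prefix_gen S s) = \<phi> s)"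
proof -
  interpret S: inverse_monoid S by fact
  interpret T: inverse_monoid T by fact
  define h where "h = (\<lambda>(A, s). T.meet_plus_set \<phi> A \<otimes>\<^bsub>T\<^esub> \<phi> s)"
  have one: "\<phi> \<one> = \<one>\<^bsub>T\<^esub>" and \<phi>: "\<phi> \<in> carrier S \<rightarrow> carrier T"
    using strong by (simp_all add: strong_premorphism_def premorphism_def)
  then have \<phi>c [simp]: "s \<in> carrier S \<Longrightarrow> \<phi> s \<in> carrier T" for s by auto
  have plus: "\<phi> s \<otimes>\<^bsub>T\<^esub> \<phi> t = pinv_plus T (\<phi> s) \<otimes>\<^bsub>T\<^esub> \<phi> (s \<otimes> t)"
    and star: "\<phi> s \<otimes>\<^bsub>T\<^esub> \<phi> t = \<phi> (s \<otimes> t) \<otimes>\<^bsub>T\<^esub> pinv_star T (\<phi> t)"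
    if "s \<in> carrier S" "t \<in> carrier S" for s t
    using that strong unfolding strong_premorphism_def by blast+
  have h: "h (set xs, s) = T.meet_plus \<phi> xs \<otimes>\<^bsub>T\<^esub> \<phi> s" if "set xs \<subseteq> carrier S" for xs s
    unfolding h_def prod.case using that by (subst T.meet_plus_set_eq) auto
  have mc [simp]: "T.meet_plus \<phi> xs \<in> carrier T" if "set xs \<subseteq> carrier S" for xs
    using that by (intro T.meet_plus_closed) auto
  \<comment> \<open>By \<open>plus\<close> at (e, e), the square of \<phi>(e) is \<phi>(e)^+
    \<phi>(e).\<close>
  have idem: "\<phi> e \<otimes>\<^bsub>T\<^esub> \<phi> e = \<phi> e" if "e \<in> carrier S" "e \<otimes> e = e" for e
    using plus[of e e] that by (simp add: T.pinv_plus_mult_self)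
  \<comment> \<open>By \<open>star\<close> at (s^+, s), using s^+ s = s.\<close>
  have idem_plus: "\<phi> (pinv_plus S s) \<otimes>\<^bsub>T\<^esub> \<phi> s = \<phi> s" if "s \<in> carrier S" for s
    using star[of "pinv_plus S s" s] that by (simp add: S.pinv_plus_mult_self T.mult_pinv_star_self)
  have shift: "\<phi> s \<otimes>\<^bsub>T\<^esub> T.meet_plus \<phi> ys = T.meet_plus \<phi> (map ((\<otimes>) s) ys) \<otimes>\<^bsub>T\<^esub> \<phi> s"
    if s: "s \<in> carrier S" and "set ys \<subseteq> carrier S" for s ys
    using that(2)
  proof (induction ys)
    case Nil
    then show ?case using s by simp
  next
    case (Cons b ys)
    have b: "b \<in> carrier S" "set ys \<subseteq> carrier S" using Cons.prems by auto
    have sys: "set (map ((\<otimes>) s) ys) \<subseteq> carrier S" using s b by auto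
    have "\<phi> s \<otimes>\<^bsub>T\<^esub> pinv_plus T (\<phi> b) = pinv_plus T (\<phi> s \<otimes>\<^bsub>T\<^esub> \<phi> b) \<otimes>\<^bsub>T\<^esub> \<phi> s"
      using s b by (simp add: T.mult_pinv_plus)
    \<comment> \<open>Strongness enters here: \<phi>(s) \<phi>(b) = \<phi>(s)^+ \<phi>(sb), and the
      extra factor \<phi>(s)^+ is absorbed by the \<phi>(s) that follows.\<close>
    also have "pinv_plus T (\<phi> s \<otimes>\<^bsub>T\<^esub> \<phi> b) = pinv_plus T (\<phi> s) \<otimes>\<^bsub>T\<^esub> pinv_plus T (\<phi> (s \<otimes> b))"
      using s b by (simp add: plus T.pinv_plus_idem_mult T.pinv_plus_idem)
    also have "\<dots> = pinv_plus T (\<phi> (s \<otimes> b)) \<otimes>\<^bsub>T\<^esub> pinv_plus T (\<phi> s)"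
      using s b by (simp add: T.pinv_plus_commute)
    finally have 1: "\<phi> s \<otimes>\<^bsub>T\<^esub> pinv_plus T (\<phi> b) = pinv_plus T (\<phi> (s \<otimes> b)) \<otimes>\<^bsub>T\<^esub> \<phi> s"
      using s b by (simp add: T.m_assoc T.pinv_plus_mult_self)
    have "\<phi> s \<otimes>\<^bsub>T\<^esub> T.meet_plus \<phi> (b # ys)
        = pinv_plus T (\<phi> (s \<otimes> b)) \<otimes>\<^bsub>T\<^esub> (\<phi> s \<otimes>\<^bsub>T\<^esub> T.meet_plus \<phi> ys)"
      using s b 1 by (simp add: T.m_assoc[symmetric])
    then show ?case using Cons.IH s b mc[OF sys] by (simp add: T.m_assoc)
  qed
  \<comment> \<open>This is \<open>shift\<close> at the idempotent e, with \<phi>(e) moved back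
    across the meet as a commuting idempotent.\<close>
  have below: "T.meet_plus \<phi> xs \<otimes>\<^bsub>T\<^esub> \<phi> e = T.meet_plus \<phi> (map ((\<otimes>) e) xs) \<otimes>\<^bsub>T\<^esub> \<phi> e"
    if e: "e \<in> carrier S" "e \<otimes> e = e" and "set xs \<subseteq> carrier S" for e xs
  proof -
    have "\<phi> ` set xs \<subseteq> carrier T" using that(3) by auto
    then show ?thesis
      using shift[OF e(1) that(3)] T.meet_plus_commute[of \<phi> xs "\<phi> e"] idem[OF e] e(1) by simp
  qed
  have hm: "h (x \<otimes>\<^bsub>prefix_expansion S\<^esub> y) = h x \<otimes>\<^bsub>T\<^esub> h y"
    if xy: "x \<in> carrier (prefix_expansion S)" "y \<in> carrier (prefix_expansion S)" for x y
  proof -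
    obtain A s B t where x: "x = (A, s)" and y: "y = (B, t)" by fastforce
    note c = S.prefix_expansion_carrierD[OF xy(1)[unfolded x]]
      S.prefix_expansion_carrierD[OF xy(2)[unfolded y]]
    obtain xs ys where A: "A = set xs" and B: "B = set ys" using c finite_list by metis
    have st: "s \<in> carrier S" "t \<in> carrier S" "s \<in> set xs" "set xs \<subseteq> carrier S" "set ys \<subseteq> carrier S"
      using c A B by auto
    let ?e = "pinv_plus S (s \<otimes> t)"
    have e: "?e \<in> carrier S" "?e \<otimes> ?e = ?e" using st by (simp_all add: S.pinv_plus_idem)
    let ?X = "T.meet_plus \<phi> xs" and ?X' = "T.meet_plus \<phi> (map ((\<otimes>) ?e) xs)"
      and ?Y = "T.meet_plus \<phi> ys" and ?Y' = "T.meet_plus \<phi> (map ((\<otimes>) s) ys)"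
    have sub: "set (map ((\<otimes>) ?e) xs) \<subseteq> carrier S" "set (map ((\<otimes>) s) ys) \<subseteq> carrier S"
      using st by auto
    have cl [simp]: "?X \<in> carrier T" "?X' \<in> carrier T" "?Y \<in> carrier T" "?Y' \<in> carrier T"
      using st sub by (blast intro: mc)+
    have comm: "?Y' \<otimes>\<^bsub>T\<^esub> f = f \<otimes>\<^bsub>T\<^esub> ?Y'" if "f \<in> carrier T" "f \<otimes>\<^bsub>T\<^esub> f = f" for f
      using that sub(2) by (intro T.meet_plus_commute) auto
    \<comment> \<open>Since s belongs to A, \<phi>(s)^+ is already a factor of
      \<open>?X\<close>.\<close>
    have abs: "?X \<otimes>\<^bsub>T\<^esub> pinv_plus T (\<phi> s) = ?X"
      using st by (intro T.meet_plus_absorb) auto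
    have "h x \<otimes>\<^bsub>T\<^esub> h y = ?X \<otimes>\<^bsub>T\<^esub> (\<phi> s \<otimes>\<^bsub>T\<^esub> ?Y) \<otimes>\<^bsub>T\<^esub> \<phi> t"
      using st by (simp add: x y A B h T.m_assoc)
    also have "\<dots> = ?X \<otimes>\<^bsub>T\<^esub> ?Y' \<otimes>\<^bsub>T\<^esub> (\<phi> s \<otimes>\<^bsub>T\<^esub> \<phi> t)"
      using st by (simp add: shift T.m_assoc)
    also have "\<dots> = ?X \<otimes>\<^bsub>T\<^esub> (?Y' \<otimes>\<^bsub>T\<^esub> pinv_plus T (\<phi> s)) \<otimes>\<^bsub>T\<^esub> \<phi> (s \<otimes> t)"
      using st by (simp add: plus T.m_assoc)
    also have "\<dots> = (?X \<otimes>\<^bsub>T\<^esub> pinv_plus T (\<phi> s)) \<otimes>\<^bsub>T\<^esub> ?Y' \<otimes>\<^bsub>T\<^esub> \<phi> (s \<otimes> t)"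
      using st by (simp add: comm T.pinv_plus_idem T.m_assoc)
    \<comment> \<open>The factor \<phi>(e) is inserted by \<open>idem_plus\<close> at st. Moved next
      to \<open>?X\<close>, it allows \<open>below\<close> to replace \<open>?X\<close> by
      \<open>?X'\<close>; it then returns to \<phi>(st) and is absorbed again.\<close>
    also have "\<dots> = ?X \<otimes>\<^bsub>T\<^esub> ?Y' \<otimes>\<^bsub>T\<^esub> (\<phi> ?e \<otimes>\<^bsub>T\<^esub> \<phi> (s \<otimes> t))"
      using st by (simp add: abs idem_plus)
    also have "\<dots> = ?X \<otimes>\<^bsub>T\<^esub> \<phi> ?e \<otimes>\<^bsub>T\<^esub> ?Y' \<otimes>\<^bsub>T\<^esub> \<phi> (s \<otimes> t)"
      using st comm[of "\<phi> ?e"] idem[OF e] e(1) by (simp add: T.m_assoc[symmetric]) (simp add: T.m_assoc)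
    also have "\<dots> = ?X' \<otimes>\<^bsub>T\<^esub> \<phi> ?e \<otimes>\<^bsub>T\<^esub> ?Y' \<otimes>\<^bsub>T\<^esub> \<phi> (s \<otimes> t)"
      using below[OF e st(4)] by simp
    also have "\<dots> = ?X' \<otimes>\<^bsub>T\<^esub> ?Y' \<otimes>\<^bsub>T\<^esub> (\<phi> ?e \<otimes>\<^bsub>T\<^esub> \<phi> (s \<otimes> t))"
      using st comm[of "\<phi> ?e"] idem[OF e] e(1) by (simp add: T.m_assoc[symmetric]) (simp add: T.m_assoc)
    also have "\<dots> = T.meet_plus \<phi> (map ((\<otimes>) ?e) xs @ map ((\<otimes>) s) ys) \<otimes>\<^bsub>T\<^esub> \<phi> (s \<otimes> t)"
      using st sub by (subst T.meet_plus_append) (auto simp: idem_plus)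
    also have "\<dots> = h (set (map ((\<otimes>) ?e) xs @ map ((\<otimes>) s) ys), s \<otimes> t)"
      using sub by (intro h[symmetric]) auto
    also have "\<dots> = h (x \<otimes>\<^bsub>prefix_expansion S\<^esub> y)"
      by (simp add: x y A B S.prefix_expansion_mult)
    finally show ?thesis by simp
  qed
  have hc: "h x \<in> carrier T" if x: "x \<in> carrier (prefix_expansion S)" for x
  proof -
    obtain A s where xA: "x = (A, s)" by fastforce
    note c = S.prefix_expansion_carrierD[OF x[unfolded xA]]
    obtain xs where A: "A = set xs" using c finite_list by metis
    show ?thesis using c by (simp add: xA A h)
  qed
  have "h \<in> hom (prefix_expansion S) T" using hc hm by (intro homI) auto
  moreover have "h \<one>\<^bsub>prefix_expansion S\<^esub> = \<one>\<^bsub>T\<^esub>"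
    using h[of "[\<one>]" \<one>] by (simp add: S.prefix_expansion_one one T.pinv_plus_one)
  moreover have "h (prefix_gen S s) = \<phi> s" if s: "s \<in> carrier S" for s
  proof -
    \<comment> \<open>On the set {s, s^+} the meet is \<phi>(s)^+ \<phi>(s^+), and both factors are
      absorbed by \<phi>(s).\<close>
    have "pinv_plus T (\<phi> (pinv_plus S s)) = \<phi> (pinv_plus S s)"
      using s by (intro T.pinv_plus_of_idem idem) (simp_all add: S.pinv_plus_idem)
    then show ?thesis
      using s h[of "[s, pinv_plus S s]" s]
      by (simp add: prefix_gen_def T.m_assoc idem_plus T.pinv_plus_mult_self)
  qed
  ultimately show ?thesis by blast
qed

subsection \<open>The presentation\<close>

text \<open>A word is built letter by letter, and the class of a formal inverse letter is the
  inverse of a generator by \<open>presentation_pinv\<close>.\<close>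

lemma presentation_generated:
  "inverse_generate (inverse_presentation X R) ((\<lambda>x. pres_class X R (gen x)) ` X)
    = carrier (inverse_presentation X R)" (is "?I = _")
proof
  interpret P: inverse_monoid "inverse_presentation X R" by (rule presentation_inverse_monoid)
  show "?I \<subseteq> carrier (inverse_presentation X R)"
    by (rule P.inverse_generate_closed) (auto simp: presentation_carrier)
  have "w \<in> words X \<Longrightarrow> pres_class X R w \<in> ?I" for w
  proof (induction w)
    case Nil
    then show ?case using inverse_generate.one[of "inverse_presentation X R"] by (simp add: presentation_one)
  next
    case (Cons a w)
    obtain x b where a: "a = (x, b)" by fastforce
    have x: "x \<in> X" "w \<in> words X" using Cons.prems a by (auto simp: words_def)
    have g: "pres_class X R (gen x) \<in> ?I" using x by (auto intro: inverse_generate.incl)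
    have "[a] \<in> words X" using x a by (simp add: words_def)
    moreover have "pres_class X R [a] \<in> ?I"
    proof (cases b)
      case True
      then show ?thesis using g by (simp add: a gen_def)
    next
      case False
      have "pres_class X R (winv (gen x)) \<in> ?I"
        using inverse_generate.pinv[OF g] x by (simp add: presentation_pinv)
      then show ?thesis using False by (simp add: a gen_def winv_def)
    qed
    ultimately show ?case
      using inverse_generate.mult[of "pres_class X R [a]" "inverse_presentation X R" _ "pres_class X R w"]
        Cons.IH x presentation_mult[of "[a]" X w R] by simp
  qed
  then show "carrier (inverse_presentation X R) \<subseteq> ?I" by (auto simp: presentation_carrier)
qed

section \<open>Comparison of the two sets of relations\<close>

lemma pres_cong_replace_rels:
  assumes "pres_cong X R u v"
    and "\<And>u v. (u, v) \<in> R \<Longrightarrow> u \<in> words X \<Longrightarrow> v \<in> words X \<Longrightarrow> pres_cong X R' u v"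
  shows "pres_cong X R' u v"
  using assms(1) by induction (auto intro: pres_cong.intros assms(2))

text \<open>In the presented monoid the assumption writes [s][t] as an idempotent times the class of
  u, so [s][t] lies below that class. By \<open>natural_le_iff\<close> the idempotent can be taken
  to be ([s][t])^+, which is the form used in \<open>rel_le\<close>.\<close>

lemma pres_cong_le_of_plus:
  assumes s: "s \<in> X" and t: "t \<in> X" and u: "u \<in> words X"
    and st: "pres_cong X R (gen s @ gen t) ((gen s @ winv (gen s)) @ u)"
  shows "pres_cong X R (gen s @ gen t) ((gen s @ gen t) @ winv (gen s @ gen t) @ u)"
proof -
  let ?P = "inverse_presentation X R"
  interpret P: inverse_monoid ?P by (rule presentation_inverse_monoid)
  let ?c = "pres_class X R"
  have c: "?c w \<in> carrier ?P" if "w \<in> words X" for w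
    using that by (simp add: presentation_carrier)
  have plus: "pinv_plus ?P (?c w) = ?c (w @ winv w)" if "w \<in> words X" for w
    using that by (simp add: pinv_plus_def presentation_pinv presentation_mult)
  have "?c (gen s @ gen t) = pinv_plus ?P (?c (gen s)) \<otimes>\<^bsub>?P\<^esub> ?c u"
    using s t u st by (simp add: plus presentation_mult pres_class_eq_iff)
  then have "natural_le ?P (?c (gen s @ gen t)) (?c u)"
    unfolding natural_le_def using c[of "gen s"] s
    by (intro bexI[of _ "pinv_plus ?P (?c (gen s))"]) (auto simp: P.pinv_plus_idem)
  then have "?c (gen s @ gen t) = pinv_plus ?P (?c (gen s @ gen t)) \<otimes>\<^bsub>?P\<^esub> ?c u"
    using s t u c by (subst (asm) P.natural_le_iff) auto
  then show ?thesis using s t u by (simp add: plus presentation_mult pres_class_eq_iff)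
qed

text \<open>Each relation of one set holds in the congruence generated by the other; for
  \<open>rel_le\<close> this is \<open>pres_cong_le_of_plus\<close> applied to a relation from
  \<open>rel_plus\<close>. The classes coincide as sets of words, so the two presented monoids are
  equal and not merely isomorphic.\<close>

lemma pres_class_FI_Rs_rels:
  fixes S (structure)
  assumes "monoid S"
  shows "pres_class (carrier S) (rel_one S \<union> rel_star S \<union> rel_plus S)
    = pres_class (carrier S) (FI_Rs_rels S)"
proof -
  interpret monoid S by fact
  let ?R = "rel_one S \<union> rel_star S \<union> rel_plus S"
  have "pres_cong (carrier S) ?R u v"
    if uv: "(u, v) \<in> FI_Rs_rels S" and w: "u \<in> words (carrier S)" "v \<in> words (carrier S)" for u v
  proof (cases "(u, v) \<in> rel_le S")
    case True
    then obtain s t where s: "s \<in> carrier S" and t: "t \<in> carrier S"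
      and u: "u = gen s @ gen t" and v: "v = (gen s @ gen t) @ winv (gen s @ gen t) @ gen (s \<otimes> t)"
      unfolding rel_le_def by blast
    have "(gen s @ gen t, (gen s @ winv (gen s)) @ gen (s \<otimes> t)) \<in> ?R"
      using s t unfolding rel_plus_def by blast
    then have "pres_cong (carrier S) ?R (gen s @ gen t) ((gen s @ winv (gen s)) @ gen (s \<otimes> t))"
      using s t by (intro pres_cong.rel) auto
    then show ?thesis unfolding u v using s t by (intro pres_cong_le_of_plus) auto
  next
    case False
    then have "(u, v) \<in> ?R" using uv by (auto simp: FI_Rs_rels_def)
    then show ?thesis using w by (rule pres_cong.rel)
  qed
  moreover have "pres_cong (carrier S) (FI_Rs_rels S) u v"
    if "(u, v) \<in> ?R" "u \<in> words (carrier S)" "v \<in> words (carrier S)" for u v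
    using that by (intro pres_cong.rel) (auto simp: FI_Rs_rels_def)
  ultimately have "pres_cong (carrier S) ?R = pres_cong (carrier S) (FI_Rs_rels S)"
    by (intro ext iffI) (erule pres_cong_replace_rels, blast)+
  then show ?thesis by (simp add: pres_class_def fun_eq_iff)
qed

lemma inverse_presentation_FI_Rs:
  "monoid S \<Longrightarrow>
    inverse_presentation (carrier S) (rel_one S \<union> rel_star S \<union> rel_plus S) = FI_Rs S"
  unfolding FI_Rs_def inverse_presentation_def by (simp add: pres_class_FI_Rs_rels)

text \<open>Each universal property yields one map, h from \<open>strong_premorphism_extends\<close>
  and k from \<open>FI_Rs_universal\<close>. Both composites fix generators of their monoid, so they
  agree with the identity by \<open>hom_eq_on_inverse_generate\<close>.\<close>

lemma prefix_expansion_FI_Rs_mutual_inverse: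
  assumes "inverse_monoid S"
  obtains h k where "h \<in> hom (prefix_expansion S) (FI_Rs S)" "k \<in> hom (FI_Rs S) (prefix_expansion S)"
    "\<forall>s \<in> carrier S. h (prefix_gen S s) = FI_Rs_gen S s"
    "\<forall>s \<in> carrier S. k (FI_Rs_gen S s) = prefix_gen S s"
    "\<forall>x \<in> carrier (prefix_expansion S). k (h x) = x"
    "\<forall>y \<in> carrier (FI_Rs S). h (k y) = y"
proof -
  interpret S: inverse_monoid S by fact
  note FI = FI_Rs_strong_premorphism[OF S.monoid_axioms]
  interpret P: inverse_monoid "prefix_expansion S" by (rule S.prefix_expansion_inverse_monoid)
  interpret F: inverse_monoid "FI_Rs S" by (rule FI(1))
  obtain h where h: "h \<in> hom (prefix_expansion S) (FI_Rs S)"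
      "h \<one>\<^bsub>prefix_expansion S\<^esub> = \<one>\<^bsub>FI_Rs S\<^esub>" "\<forall>s \<in> carrier S. h (prefix_gen S s) = FI_Rs_gen S s"
    using strong_premorphism_extends[OF assms FI] by blast
  obtain k where k: "k \<in> hom (FI_Rs S) (prefix_expansion S)"
      "k \<one>\<^bsub>FI_Rs S\<^esub> = \<one>\<^bsub>prefix_expansion S\<^esub>" "\<forall>s \<in> carrier S. k (FI_Rs_gen S s) = prefix_gen S s"
    using FI_Rs_universal[OF S.monoid_axioms P.inverse_monoid_axioms S.prefix_gen_strong_premorphism]
    by blast
  have genc: "FI_Rs_gen S ` carrier S \<subseteq> carrier (FI_Rs S)"
    using FI(2) by (auto simp: strong_premorphism_def premorphism_def)
  have generated: "inverse_generate (FI_Rs S) (FI_Rs_gen S ` carrier S) = carrier (FI_Rs S)"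
    using presentation_generated[of "carrier S" "FI_Rs_rels S"]
    by (simp add: FI_Rs_def FI_Rs_gen_def[abs_def])
  have "(k \<circ> h) x = id x" if "x \<in> carrier (prefix_expansion S)" for x
  proof (rule P.hom_eq_on_inverse_generate[OF P.inverse_monoid_axioms, where f = "k \<circ> h" and g = id
      and X = "prefix_gen S ` carrier S"])
    show "k \<circ> h \<in> hom (prefix_expansion S) (prefix_expansion S)" using h k by (intro hom_compose)
    show "id \<in> hom (prefix_expansion S) (prefix_expansion S)" by (auto intro: homI)
    show "x \<in> inverse_generate (prefix_expansion S) (prefix_gen S ` carrier S)"
      using that by (simp add: S.prefix_expansion_generated)
  qed (use h k S.prefix_gen_closed in auto)
  moreover have "(h \<circ> k) y = id y" if "y \<in> carrier (FI_Rs S)" for y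
  proof (rule F.hom_eq_on_inverse_generate[OF F.inverse_monoid_axioms, where f = "h \<circ> k" and g = id
      and X = "FI_Rs_gen S ` carrier S"])
    show "h \<circ> k \<in> hom (FI_Rs S) (FI_Rs S)" using h k by (intro hom_compose)
    show "id \<in> hom (FI_Rs S) (FI_Rs S)" by (auto intro: homI)
    show "y \<in> inverse_generate (FI_Rs S) (FI_Rs_gen S ` carrier S)"
      using that by (simp add: generated)
  qed (use h k genc in auto)
  ultimately show ?thesis using h k by (intro that[of h k]) auto
qed

lemma iso_of_mutual_inverse:
  assumes "h \<in> hom G H" "k \<in> hom H G" "\<forall>x \<in> carrier G. k (h x) = x" "\<forall>y \<in> carrier H. h (k y) = y"
  shows "h \<in> iso G H"
  using assms unfolding iso_def by (auto intro!: bij_betw_byWitness[of _ k] simp: hom_def)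

theorem theorem8p8:
  fixes S :: "('a, 'm) monoid_scheme" (structure)
  assumes "inverse_monoid S"
  shows "(\<exists>h \<in> iso (prefix_expansion S) (FI_Rs S). \<forall>s \<in> carrier S. h (prefix_gen S s) = FI_Rs_gen S s)
    \<and> inverse_monoid (prefix_expansion S)
    \<and> inverse_generate (prefix_expansion S) (prefix_gen S ` carrier S) = carrier (prefix_expansion S)
    \<and> (let R = rel_one S \<union> rel_star S \<union> rel_plus S in
        \<exists>h \<in> iso (inverse_presentation (carrier S) R) (prefix_expansion S).
          \<forall>s \<in> carrier S. h (pres_class (carrier S) R (gen s)) = prefix_gen S s)"
proof -
  interpret S: inverse_monoid S by fact
  obtain h k where hk: "h \<in> hom (prefix_expansion S) (FI_Rs S)" "k \<in> hom (FI_Rs S) (prefix_expansion S)"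
    "\<forall>s \<in> carrier S. h (prefix_gen S s) = FI_Rs_gen S s"
    "\<forall>s \<in> carrier S. k (FI_Rs_gen S s) = prefix_gen S s"
    "\<forall>x \<in> carrier (prefix_expansion S). k (h x) = x"
    "\<forall>y \<in> carrier (FI_Rs S). h (k y) = y"
    using assms by (rule prefix_expansion_FI_Rs_mutual_inverse)
  \<comment> \<open>The map h serves the first isomorphism and k the last one, since the monoid
    presented by the three families of relations is \<open>FI_Rs S\<close> itself.\<close>
  have "h \<in> iso (prefix_expansion S) (FI_Rs S)" "k \<in> iso (FI_Rs S) (prefix_expansion S)"
    using hk by (auto intro: iso_of_mutual_inverse)
  then show ?thesis
    using hk S.prefix_expansion_inverse_monoid S.prefix_expansion_generated
    unfolding Let_def inverse_presentation_FI_Rs[OF S.monoid_axioms]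
      pres_class_FI_Rs_rels[OF S.monoid_axioms] FI_Rs_gen_def[symmetric]
    by blast
qed

end
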